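(* Let $\langle u_n\rangle_{n=0}^\infty$ be a sequence of integers satisfying the order-$d$ linear recurrence $u_{n+d}=a_{d-1}u_{n+d-1}+\cdots+a_0u_n$ ($n\in\mathbb N$) with $a_0,\dots,a_{d-1}\in\mathbb Z$, and let $p>d+1$ be a prime not dividing $a_0$. Then there exist an integer $M$ with $0<M<p^{d^2}$ and analytic functions $F_\ell:\mathbb Z_p\to\mathbb Z_p$, $\ell\in\{0,\dots,M-1\}$, such that for all $\ell$: (1) $F_\ell(n)=u_{Mn+\ell}$ for all $n\in\mathbb N$; and, whenever $F_\ell$ is not identically zero, (2) $V(F_\ell)=\min\{v_p((\Delta^jF_\ell)(0)) : 0\le j\le d-1\}$; (3) $j(F_\ell)=\max\{j\in\{0,\dots,d-1\} : v_p((\Delta^jF_\ell)(0))=V(F_\ell)\}$.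
   Context: $v_p$ denotes the $p$-adic valuation on $\mathbb Q_p$, and $\mathbb Z_p=\{x\in\mathbb Q_p: v_p(x)\ge0\}$. A function $F:\mathbb Z_p\to\mathbb Z_p$ is analytic if it is given by a power series $F(x)=\sum_{j\ge0}b_jx^j$ with $b_j\in\mathbb Z_p$ and $v_p(b_j)\to\infty$. For such a non-zero $F$, $V(F):=\min_j v_p(b_j)$ and $j(F)$ is the largest index $j$ with $v_p(b_j)=V(F)$. The difference operator is $(\Delta F)(x)=F(x+1)-F(x)$, so $(\Delta^kF)(0)=\sum_{i=0}^k(-1)^{k-i}\binom{k}{i}F(i)$. *)

theory Defs
  imports "HOL-Analysis.Analysis"
begin

section \<open>The \<open>p\<close>-adic valuation on the rationals\<close>

definition rat_val :: "nat \<Rightarrow> rat \<Rightarrow> ereal" where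
  "rat_val p r =
    (if r = 0 then \<infinity>
     else case quotient_of r of (a, b) \<Rightarrow>
       ereal (real (multiplicity (int p) a) - real (multiplicity (int p) b)))"

definition padic_vanishes :: "nat \<Rightarrow> (nat \<Rightarrow> rat) \<Rightarrow> bool" where
  "padic_vanishes p X \<longleftrightarrow> (\<forall>k::real. \<exists>N. \<forall>n\<ge>N. ereal k \<le> rat_val p (X n))"

definition padic_cauchy :: "nat \<Rightarrow> (nat \<Rightarrow> rat) \<Rightarrow> bool" where
  "padic_cauchy p X \<longleftrightarrow>
    (\<forall>k::real. \<exists>N. \<forall>m\<ge>N. \<forall>n\<ge>N. ereal k \<le> rat_val p (X m - X n))"

definition padic_rel :: "nat \<Rightarrow> (nat \<Rightarrow> rat) \<Rightarrow> (nat \<Rightarrow> rat) \<Rightarrow> bool" where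
  "padic_rel p X Y \<longleftrightarrow>
    padic_cauchy p X \<and> padic_cauchy p Y \<and> padic_vanishes p (\<lambda>n. X n - Y n)"

lemma rat_val_zero [simp]: "rat_val p 0 = \<infinity>"
  by (simp add: rat_val_def)

lemma rat_val_eq_infty_iff [simp]: "rat_val p r = \<infinity> \<longleftrightarrow> r = 0"
  by (simp add: rat_val_def split: prod.splits)

lemma rat_val_not_MInfty [simp]: "rat_val p r \<noteq> - \<infinity>"
  by (simp add: rat_val_def split: prod.splits)

context
  fixes p :: nat
  assumes p: "prime p"
begin

lemma prime_elem_int_p: "prime_elem (int p)"
  using p by simp

lemma rat_val_of_int_div:
  assumes "a \<noteq> 0" "b \<noteq> 0"
  shows "rat_val p (of_int a / of_int b) =
    ereal (real (multiplicity (int p) a) - real (multiplicity (int p) b))"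
proof -
  define r :: rat where "r = of_int a / of_int b"
  obtain c d where cd: "quotient_of r = (c, d)" by fastforce
  have d: "d > 0" using quotient_of_denom_pos[OF cd] .
  have r: "r = of_int c / of_int d" using quotient_of_div[OF cd] .
  have nz: "r \<noteq> 0" using assms by (simp add: r_def)
  then have c: "c \<noteq> 0" using r by auto
  have "(of_int a :: rat) / of_int b = of_int c / of_int d" using r r_def by simp
  then have "(of_int (a * d) :: rat) = of_int (c * b)"
    using assms d by (simp add: field_simps)
  then have eq: "a * d = c * b" by (simp only: of_int_eq_iff)
  have "multiplicity (int p) (a * d) = multiplicity (int p) a + multiplicity (int p) d"
    using prime_elem_int_p assms d by (intro prime_elem_multiplicity_mult_distrib) auto
  moreover have "multiplicity (int p) (c * b) = multiplicity (int p) c + multiplicity (int p) b"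
    using prime_elem_int_p assms c by (intro prime_elem_multiplicity_mult_distrib) auto
  ultimately have "multiplicity (int p) a + multiplicity (int p) d =
      multiplicity (int p) c + multiplicity (int p) b"
    using eq by metis
  then have "real (multiplicity (int p) a) - real (multiplicity (int p) b) =
      real (multiplicity (int p) c) - real (multiplicity (int p) d)"
    by linarith
  then show ?thesis
    using nz cd unfolding r_def[symmetric] by (simp add: rat_val_def)
qed

lemma rat_val_of_int: "a \<noteq> 0 \<Longrightarrow> rat_val p (of_int a) = ereal (real (multiplicity (int p) a))"
  using rat_val_of_int_div[of a 1] by simp

lemma rat_val_one [simp]: "rat_val p 1 = 0"
  using rat_val_of_int[of 1] by (simp add: zero_ereal_def)

lemma rat_val_mult: "rat_val p (x * y) = rat_val p x + rat_val p y"
proof (cases "x = 0 \<or> y = 0")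
  case True
  then show ?thesis by (auto)
next
  case False
  obtain a b where x: "x = of_int a / of_int b" "b \<noteq> 0"
    by (metis quotient_of_div quotient_of_denom_pos less_irrefl surj_pair)
  obtain c d where y: "y = of_int c / of_int d" "d \<noteq> 0"
    by (metis quotient_of_div quotient_of_denom_pos less_irrefl surj_pair)
  have nz: "a \<noteq> 0" "c \<noteq> 0" using False x y by auto
  have "x * y = of_int (a * c) / of_int (b * d)" by (simp add: x y)
  then show ?thesis
    using nz x(2) y(2)
    by (simp add: x(1) y(1) rat_val_of_int_div
        prime_elem_multiplicity_mult_distrib[OF prime_elem_int_p] del: of_int_mult)
qed

lemma rat_val_minus [simp]: "rat_val p (- x) = rat_val p x"
proof (cases "x = 0")
  case False
  have "rat_val p (-1) = 0"
    using rat_val_of_int[of "-1"] by (simp add: zero_ereal_def multiplicity_unit_right)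
  then show ?thesis using rat_val_mult[of "-1" x] by simp
qed simp

lemma rat_val_diff_commute: "rat_val p (x - y) = rat_val p (y - x)"
  using rat_val_minus[of "x - y"] by simp

lemma rat_val_add_ge:
  assumes "c \<le> rat_val p x" "c \<le> rat_val p y"
  shows "c \<le> rat_val p (x + y)"
proof (cases "x = 0 \<or> y = 0 \<or> x + y = 0")
  case True
  then show ?thesis using assms by auto
next
  case False
  obtain a b where x: "x = of_int a / of_int b" "b \<noteq> 0"
    by (metis quotient_of_div quotient_of_denom_pos less_irrefl surj_pair)
  obtain c' d where y: "y = of_int c' / of_int d" "d \<noteq> 0"
    by (metis quotient_of_div quotient_of_denom_pos less_irrefl surj_pair)
  let ?m = "multiplicity (int p)"
  have nz: "a \<noteq> 0" "c' \<noteq> 0" using False x y by auto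
  have s: "x + y = of_int (a * d + c' * b) / of_int (b * d)"
    using x y by (simp add: field_simps)
  have nz': "a * d + c' * b \<noteq> 0" using s False by force
  have "int p ^ min (?m (a * d)) (?m (c' * b)) dvd a * d + c' * b"
    by (intro dvd_add multiplicity_dvd') auto
  then have "min (?m (a * d)) (?m (c' * b)) \<le> ?m (a * d + c' * b)"
    using nz' p by (intro multiplicity_geI) (auto simp: prime_gt_1_nat)
  then have "min (?m a + ?m d) (?m c' + ?m b) \<le> ?m (a * d + c' * b)"
    using nz x(2) y(2) by (simp add: prime_elem_multiplicity_mult_distrib[OF prime_elem_int_p])
  then have "min (real (?m a) - real (?m b)) (real (?m c') - real (?m d)) \<le>
      real (?m (a * d + c' * b)) - (real (?m b) + real (?m d))"
    by linarith
  moreover have "rat_val p x = ereal (real (?m a) - real (?m b))"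
    unfolding x(1) using nz x(2) by (intro rat_val_of_int_div)
  moreover have "rat_val p y = ereal (real (?m c') - real (?m d))"
    unfolding y(1) using nz y(2) by (intro rat_val_of_int_div)
  moreover have "rat_val p (x + y) =
      ereal (real (?m (a * d + c' * b)) - (real (?m b) + real (?m d)))"
    unfolding s using nz' x(2) y(2)
    by (subst rat_val_of_int_div)
      (simp_all add: prime_elem_multiplicity_mult_distrib[OF prime_elem_int_p])
  ultimately have "min (rat_val p x) (rat_val p y) \<le> rat_val p (x + y)"
    by (simp only: ereal_min[symmetric] ereal_less_eq(3))
  then show ?thesis using assms by (meson min.boundedI order_trans)
qed

lemma rat_val_diff_ge:
  "c \<le> rat_val p x \<Longrightarrow> c \<le> rat_val p y \<Longrightarrow> c \<le> rat_val p (x - y)"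
  using rat_val_add_ge[of c x "- y"] by simp

lemma rat_val_mult_ge:
  assumes "ereal j \<le> rat_val p x" "ereal k \<le> rat_val p y"
  shows "ereal (j + k) \<le> rat_val p (x * y)"
  using add_mono[OF assms] by (simp add: rat_val_mult)

lemma rat_val_cong:
  assumes "rat_val p x < rat_val p (x - y)"
  shows "rat_val p y = rat_val p x"
proof (rule antisym)
  show "rat_val p x \<le> rat_val p y"
    using rat_val_diff_ge[of "rat_val p x" x "x - y"] assms by simp
  show "rat_val p y \<le> rat_val p x"
  proof (rule ccontr)
    assume "\<not> rat_val p y \<le> rat_val p x"
    then have "rat_val p x < min (rat_val p y) (rat_val p (x - y))" using assms by simp
    also have "\<dots> \<le> rat_val p (x - y + y)"
      by (rule rat_val_add_ge) auto
    finally show False by simp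
  qed
qed

lemma rat_val_inverse:
  assumes "rat_val p x = ereal c"
  shows "rat_val p (inverse x) = ereal (- c)"
proof -
  have "x \<noteq> 0" using assms by auto
  then have "rat_val p x + rat_val p (inverse x) = 0"
    by (simp flip: rat_val_mult)
  then show ?thesis
    using assms by (cases "rat_val p (inverse x)") (auto simp: zero_ereal_def)
qed


section \<open>Cauchy sequences\<close>

lemma padic_vanishesD:
  "padic_vanishes p X \<Longrightarrow> \<exists>N. \<forall>n\<ge>N. ereal k \<le> rat_val p (X n)"
  by (simp add: padic_vanishes_def)

lemma padic_cauchyD:
  "padic_cauchy p X \<Longrightarrow> \<exists>N. \<forall>m\<ge>N. \<forall>n\<ge>N. ereal k \<le> rat_val p (X m - X n)"
  by (simp add: padic_cauchy_def)

lemma padic_vanishes_zero [simp]: "padic_vanishes p (\<lambda>n. 0)"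
  by (simp add: padic_vanishes_def)

lemma padic_vanishes_const [simp]: "padic_vanishes p (\<lambda>n. c) \<longleftrightarrow> c = 0"
proof
  assume v: "padic_vanishes p (\<lambda>n. c)"
  show "c = 0"
  proof (cases "rat_val p c")
    case (real r)
    then show ?thesis using padic_vanishesD[OF v, of "r + 1"] by auto
  qed auto
qed simp

lemma padic_vanishes_minus: "padic_vanishes p X \<Longrightarrow> padic_vanishes p (\<lambda>n. - X n)"
  by (simp add: padic_vanishes_def)

lemma padic_vanishes_add:
  assumes "padic_vanishes p X" "padic_vanishes p Y"
  shows "padic_vanishes p (\<lambda>n. X n + Y n)"
  unfolding padic_vanishes_def
proof
  fix k :: real
  obtain M where M: "\<forall>n\<ge>M. ereal k \<le> rat_val p (X n)" using padic_vanishesD[OF assms(1)] ..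
  obtain N where N: "\<forall>n\<ge>N. ereal k \<le> rat_val p (Y n)" using padic_vanishesD[OF assms(2)] ..
  show "\<exists>N. \<forall>n\<ge>N. ereal k \<le> rat_val p (X n + Y n)"
    using M N by (intro exI[of _ "max M N"]) (simp add: rat_val_add_ge)
qed

lemma padic_vanishes_diff:
  "padic_vanishes p X \<Longrightarrow> padic_vanishes p Y \<Longrightarrow> padic_vanishes p (\<lambda>n. X n - Y n)"
  using padic_vanishes_add[of X "\<lambda>n. - Y n"] padic_vanishes_minus[of Y] by simp

lemma padic_cauchy_const [simp]: "padic_cauchy p (\<lambda>n. c)"
  by (simp add: padic_cauchy_def)

lemma padic_cauchy_minus [simp]:
  assumes "padic_cauchy p X"
  shows "padic_cauchy p (\<lambda>n. - X n)"
proof -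
  have "rat_val p (- X m - - X n) = rat_val p (X m - X n)" for m n
    using rat_val_minus[of "X m - X n"] by simp
  then show ?thesis using assms unfolding padic_cauchy_def by metis
qed

lemma padic_cauchy_add [simp]:
  assumes "padic_cauchy p X" "padic_cauchy p Y"
  shows "padic_cauchy p (\<lambda>n. X n + Y n)"
  unfolding padic_cauchy_def
proof
  fix k :: real
  obtain M where M: "\<forall>m\<ge>M. \<forall>n\<ge>M. ereal k \<le> rat_val p (X m - X n)"
    using padic_cauchyD[OF assms(1)] ..
  obtain N where N: "\<forall>m\<ge>N. \<forall>n\<ge>N. ereal k \<le> rat_val p (Y m - Y n)"
    using padic_cauchyD[OF assms(2)] ..
  show "\<exists>N. \<forall>m\<ge>N. \<forall>n\<ge>N. ereal k \<le> rat_val p (X m + Y m - (X n + Y n))"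
    unfolding add_diff_add
    using M N by (intro exI[of _ "max M N"] allI impI rat_val_add_ge) auto
qed

lemma padic_cauchy_bounded:
  assumes "padic_cauchy p X"
  shows "\<exists>b. \<forall>n. ereal b \<le> rat_val p (X n)"
proof -
  obtain N where N: "\<forall>m\<ge>N. \<forall>n\<ge>N. ereal 0 \<le> rat_val p (X m - X n)"
    using padic_cauchyD[OF assms] ..
  define V where "V = insert 0 ((\<lambda>n. rat_val p (X n)) ` {..N})"
  have fin: "finite V" "V \<noteq> {}" by (auto simp: V_def)
  then have "Min V \<in> V" by (rule Min_in)
  then have "Min V \<noteq> - \<infinity>" by (auto simp: V_def)
  moreover have "Min V \<le> 0" using fin by (auto simp: V_def)
  ultimately obtain b where b: "Min V = ereal b" by (cases "Min V") auto
  have "ereal b \<le> rat_val p (X n)" for n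
  proof (cases "n \<le> N")
    case True
    then show ?thesis unfolding b[symmetric] using fin by (intro Min_le) (auto simp: V_def)
  next
    case False
    have "ereal b \<le> rat_val p (X N)"
      unfolding b[symmetric] using fin by (intro Min_le) (auto simp: V_def)
    moreover have "ereal b \<le> rat_val p (X n - X N)"
    proof -
      have "ereal b \<le> ereal 0" using \<open>Min V \<le> 0\<close> b by (simp add: zero_ereal_def)
      also have "\<dots> \<le> rat_val p (X n - X N)" using N False by simp
      finally show ?thesis .
    qed
    ultimately show ?thesis using rat_val_add_ge[of "ereal b" "X N" "X n - X N"] by simp
  qed
  then show ?thesis by blast
qed

lemma padic_vanishes_mult_bounded:
  assumes "\<exists>b. \<forall>n. ereal b \<le> rat_val p (X n)" "padic_vanishes p Y"
  shows "padic_vanishes p (\<lambda>n. X n * Y n)"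
  unfolding padic_vanishes_def
proof
  fix k :: real
  obtain b where b: "\<forall>n. ereal b \<le> rat_val p (X n)" using assms(1) ..
  obtain N where N: "\<forall>n\<ge>N. ereal (k - b) \<le> rat_val p (Y n)"
    using padic_vanishesD[OF assms(2)] ..
  have "ereal k \<le> rat_val p (X n * Y n)" if "n \<ge> N" for n
    using rat_val_mult_ge[of b "X n" "k - b" "Y n"] b N that by simp
  then show "\<exists>N. \<forall>n\<ge>N. ereal k \<le> rat_val p (X n * Y n)" by blast
qed

lemma padic_cauchy_mult [simp]:
  assumes "padic_cauchy p X" "padic_cauchy p Y"
  shows "padic_cauchy p (\<lambda>n. X n * Y n)"
  unfolding padic_cauchy_def
proof
  fix k :: real
  obtain a where a: "\<forall>n. ereal a \<le> rat_val p (X n)" using padic_cauchy_bounded[OF assms(1)] ..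
  obtain b where b: "\<forall>n. ereal b \<le> rat_val p (Y n)" using padic_cauchy_bounded[OF assms(2)] ..
  obtain M where M: "\<forall>m\<ge>M. \<forall>n\<ge>M. ereal (k - b) \<le> rat_val p (X m - X n)"
    using padic_cauchyD[OF assms(1)] ..
  obtain N where N: "\<forall>m\<ge>N. \<forall>n\<ge>N. ereal (k - a) \<le> rat_val p (Y m - Y n)"
    using padic_cauchyD[OF assms(2)] ..
  have "ereal k \<le> rat_val p (X m * Y m - X n * Y n)" if "m \<ge> max M N" "n \<ge> max M N" for m n
  proof -
    have "ereal k \<le> rat_val p (X m * (Y m - Y n))"
      using rat_val_mult_ge[of a "X m" "k - a" "Y m - Y n"] a N that by simp
    moreover have "ereal k \<le> rat_val p ((X m - X n) * Y n)"
      using rat_val_mult_ge[of "k - b" "X m - X n" b "Y n"] b M that by simp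
    ultimately show ?thesis
      using rat_val_add_ge by (metis mult_diff_mult)
  qed
  then show "\<exists>N. \<forall>m\<ge>N. \<forall>n\<ge>N. ereal k \<le> rat_val p (X m * Y m - X n * Y n)" by blast
qed

lemma padic_cauchy_not_vanishesE:
  assumes X: "padic_cauchy p X" and nz: "\<not> padic_vanishes p X"
  obtains N c where "\<forall>n\<ge>N. rat_val p (X n) = ereal c"
proof -
  obtain k where k: "\<forall>N. \<exists>n\<ge>N. \<not> ereal k \<le> rat_val p (X n)"
    using nz unfolding padic_vanishes_def by blast
  obtain N where N: "\<forall>m\<ge>N. \<forall>n\<ge>N. ereal k \<le> rat_val p (X m - X n)"
    using padic_cauchyD[OF X] ..
  obtain m where m: "m \<ge> N" "rat_val p (X m) < ereal k" using k not_le by metis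
  obtain c where c: "rat_val p (X m) = ereal c" using m(2) by (cases "rat_val p (X m)") auto
  have *: "rat_val p (X n) = ereal c" if "n \<ge> N" for n
  proof -
    have "rat_val p (X m) < rat_val p (X m - X n)"
      using m(2) N[rule_format, OF m(1) that] by (rule less_le_trans)
    from rat_val_cong[OF this] show ?thesis using c by simp
  qed
  show ?thesis by (rule that) (use * in blast)
qed

lemma rat_val_inverse_diff:
  assumes "rat_val p x = ereal c" "rat_val p y = ereal e" "ereal (k + c + e) \<le> rat_val p (x - y)"
  shows "ereal k \<le> rat_val p (inverse x - inverse y)"
proof -
  have nz: "x \<noteq> 0" "y \<noteq> 0" using assms by auto
  have eq: "inverse x - inverse y = - ((x - y) * (inverse x * inverse y))"
    using inverse_diff_inverse[OF nz] by (simp add: mult_ac)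
  have "ereal (- c + - e) \<le> rat_val p (inverse x * inverse y)"
    by (intro rat_val_mult_ge) (simp_all only: rat_val_inverse[OF assms(1)]
        rat_val_inverse[OF assms(2)] order_refl)
  then have "ereal (k + c + e + (- c + - e)) \<le> rat_val p ((x - y) * (inverse x * inverse y))"
    by (rule rat_val_mult_ge[OF assms(3)])
  then show ?thesis unfolding eq rat_val_minus by simp
qed

lemma padic_cauchy_inverse [simp]:
  assumes X: "padic_cauchy p X" and nz: "\<not> padic_vanishes p X"
  shows "padic_cauchy p (\<lambda>n. inverse (X n))"
  unfolding padic_cauchy_def
proof
  fix k :: real
  obtain c M where M: "\<forall>n\<ge>M. rat_val p (X n) = ereal c"
    by (rule padic_cauchy_not_vanishesE[OF X nz])
  obtain N where N: "\<forall>m\<ge>N. \<forall>n\<ge>N. ereal (k + c + c) \<le> rat_val p (X m - X n)"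
    using padic_cauchyD[OF X] ..
  have "ereal k \<le> rat_val p (inverse (X m) - inverse (X n))"
    if "m \<ge> max M N" "n \<ge> max M N" for m n
  proof -
    have "m \<ge> M" "n \<ge> M" "m \<ge> N" "n \<ge> N" using that by simp_all
    then show ?thesis using rat_val_inverse_diff[OF M[rule_format] M[rule_format] N[rule_format]] by blast
  qed
  then show "\<exists>N. \<forall>m\<ge>N. \<forall>n\<ge>N. ereal k \<le> rat_val p (inverse (X m) - inverse (X n))" by blast
qed

lemma padic_vanishes_diff_inverse:
  assumes X: "padic_cauchy p X" "\<not> padic_vanishes p X"
    and Y: "padic_cauchy p Y" "\<not> padic_vanishes p Y"
    and XY: "padic_vanishes p (\<lambda>n. X n - Y n)"
  shows "padic_vanishes p (\<lambda>n. inverse (X n) - inverse (Y n))"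
  unfolding padic_vanishes_def
proof
  fix k :: real
  obtain c M where M: "\<forall>n\<ge>M. rat_val p (X n) = ereal c"
    by (rule padic_cauchy_not_vanishesE[OF X])
  obtain e L where L: "\<forall>n\<ge>L. rat_val p (Y n) = ereal e"
    by (rule padic_cauchy_not_vanishesE[OF Y])
  obtain N where N: "\<forall>n\<ge>N. ereal (k + c + e) \<le> rat_val p (X n - Y n)"
    using padic_vanishesD[OF XY] ..
  have "ereal k \<le> rat_val p (inverse (X n) - inverse (Y n))" if "n \<ge> max M (max L N)" for n
  proof -
    have "n \<ge> M" "n \<ge> L" "n \<ge> N" using that by simp_all
    then show ?thesis using rat_val_inverse_diff[OF M[rule_format] L[rule_format] N[rule_format]] by blast
  qed
  then show "\<exists>N. \<forall>n\<ge>N. ereal k \<le> rat_val p (inverse (X n) - inverse (Y n))" by blast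
qed

lemma padic_rel_refl: "padic_cauchy p X \<Longrightarrow> padic_rel p X X"
  by (simp add: padic_rel_def)

lemma padic_rel_vanishes_iff:
  assumes "padic_rel p X Y"
  shows "padic_vanishes p X \<longleftrightarrow> padic_vanishes p Y"
proof -
  have XY: "padic_vanishes p (\<lambda>n. X n - Y n)" using assms by (simp add: padic_rel_def)
  show ?thesis
    using padic_vanishes_diff[OF _ XY, of X] padic_vanishes_add[OF _ XY, of Y] by auto
qed

lemma padic_rel_sym: "padic_rel p X Y \<Longrightarrow> padic_rel p Y X"
  by (auto simp: padic_rel_def padic_vanishes_def rat_val_diff_commute)

lemma padic_rel_trans: "padic_rel p X Y \<Longrightarrow> padic_rel p Y Z \<Longrightarrow> padic_rel p X Z"
  using padic_vanishes_add[of "\<lambda>n. X n - Y n" "\<lambda>n. Y n - Z n"] by (simp add: padic_rel_def)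

lemma equiv_padic_rel:
  "equiv {X. padic_cauchy p X} {(X, Y). padic_rel p X Y}"
proof (rule equivI)
  show "sym {(X, Y). padic_rel p X Y}" by (auto intro: symI padic_rel_sym)
  show "trans {(X, Y). padic_rel p X Y}" by (rule transI) (blast intro: padic_rel_trans)
qed (auto simp: padic_rel_refl refl_on_def, auto simp: padic_rel_def)

lemma rat_val_tendsto_infty:
  assumes "padic_vanishes p X"
  shows "(\<lambda>n. rat_val p (X n)) \<longlonglongrightarrow> \<infinity>"
  unfolding tendsto_PInfty eventually_sequentially
proof
  fix k :: real
  obtain N where "\<forall>n\<ge>N. ereal (k + 1) \<le> rat_val p (X n)" using padic_vanishesD[OF assms] ..
  moreover have "ereal k < ereal (k + 1)" by simp
  ultimately show "\<exists>N. \<forall>n\<ge>N. ereal k < rat_val p (X n)" by (meson less_le_trans)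
qed

lemma rat_val_lim_cong:
  assumes "padic_rel p X Y"
  shows "lim (\<lambda>n. rat_val p (X n)) = lim (\<lambda>n. rat_val p (Y n))"
proof (cases "padic_vanishes p X")
  case True
  then have "padic_vanishes p Y" using padic_rel_vanishes_iff[OF assms] by simp
  then show ?thesis using rat_val_tendsto_infty[of X] rat_val_tendsto_infty[of Y] True
    by (simp add: limI)
next
  case False
  have X: "padic_cauchy p X" and XY: "padic_vanishes p (\<lambda>n. X n - Y n)"
    using assms by (simp_all add: padic_rel_def)
  obtain c M where M: "\<forall>n\<ge>M. rat_val p (X n) = ereal c"
    by (rule padic_cauchy_not_vanishesE[OF X False])
  obtain N where N: "\<forall>n\<ge>N. ereal (c + 1) \<le> rat_val p (X n - Y n)"
    using padic_vanishesD[OF XY] ..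
  have Y: "rat_val p (Y n) = ereal c" if "n \<ge> max M N" for n
  proof -
    have "ereal c < ereal (c + 1)" by simp
    also have "\<dots> \<le> rat_val p (X n - Y n)" using N that by simp
    finally have "rat_val p (X n) < rat_val p (X n - Y n)" using M that by simp
    from rat_val_cong[OF this] show ?thesis using M that by simp
  qed
  have "(\<lambda>n. rat_val p (X n)) \<longlonglongrightarrow> ereal c"
    by (rule tendsto_eventually) (use M in \<open>auto simp: eventually_sequentially\<close>)
  moreover have "(\<lambda>n. rat_val p (Y n)) \<longlonglongrightarrow> ereal c"
    by (rule tendsto_eventually)
      (use Y in \<open>auto simp: eventually_sequentially intro!: exI[of _ "max M N"]\<close>)
  ultimately show ?thesis by (simp add: limI)
qed

end


section \<open>The field of \<open>p\<close>-adic numbers\<close>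

text \<open>The prime is carried by a type: \<open>'p padic\<close> is the completion of the rationals
  with respect to the \<open>p\<close>-adic valuation for \<open>p = CARD('p)\<close>.\<close>

class prime_card =
  assumes prime_card: "prime CARD('a)"

typedef 'p padic =
  "{X. padic_cauchy CARD('p::prime_card) X} // {(X, Y). padic_rel CARD('p) X Y}"
  by (auto simp: quotient_def intro!: exI[of _ "\<lambda>n. 0"] padic_cauchy_const prime_card)

definition Padic :: "(nat \<Rightarrow> rat) \<Rightarrow> 'p::prime_card padic" where
  "Padic X = Abs_padic ({(X, Y). padic_rel CARD('p) X Y} `` {X})"

definition seq_of :: "'p::prime_card padic \<Rightarrow> nat \<Rightarrow> rat" where
  "seq_of x = (SOME X. X \<in> Rep_padic x)"

lemma Padic_eq_iff:
  assumes "padic_cauchy CARD('p) X" "padic_cauchy CARD('p) Y"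
  shows "(Padic X :: 'p::prime_card padic) = Padic Y \<longleftrightarrow>
    padic_vanishes CARD('p) (\<lambda>n. X n - Y n)"
proof -
  have "(Padic X :: 'p padic) = Padic Y \<longleftrightarrow>
      {(X, Y). padic_rel CARD('p) X Y} `` {X} = {(X, Y). padic_rel CARD('p) X Y} `` {Y}"
    unfolding Padic_def using assms by (intro Abs_padic_inject quotientI) auto
  also have "\<dots> \<longleftrightarrow> padic_rel CARD('p) X Y"
    using eq_equiv_class_iff[OF equiv_padic_rel[OF prime_card[where 'a = 'p]], of X Y] assms
    by simp
  finally show ?thesis using assms by (simp add: padic_rel_def)
qed

lemma seq_of:
  fixes x :: "'p::prime_card padic"
  shows "padic_cauchy CARD('p) (seq_of x)" and "Padic (seq_of x) = x"
proof -
  note eq = equiv_padic_rel[OF prime_card[where 'a = 'p]]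
  note mem = Rep_padic[of x]
  have "Rep_padic x \<noteq> {}" using in_quotient_imp_non_empty[OF eq mem] .
  then have s: "seq_of x \<in> Rep_padic x" unfolding seq_of_def by (simp add: some_in_eq)
  then show "padic_cauchy CARD('p) (seq_of x)"
    using in_quotient_imp_subset[OF eq mem] by auto
  obtain Y where Y: "Rep_padic x = {(X, Y). padic_rel CARD('p) X Y} `` {Y}"
    using mem by (rule quotientE)
  have "(Y, seq_of x) \<in> {(X, Y). padic_rel CARD('p) X Y}" using s unfolding Y by simp
  from equiv_class_eq[OF eq this]
  have "{(X, Y). padic_rel CARD('p) X Y} `` {seq_of x} = Rep_padic x" unfolding Y by simp
  then show "Padic (seq_of x) = x"
    unfolding Padic_def by (simp add: Rep_padic_inverse)
qed

lemma Padic_cases [case_names Padic, cases type: padic]: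
  fixes x :: "'p::prime_card padic"
  obtains X where "padic_cauchy CARD('p) X" "x = Padic X"
  using seq_of[of x] by metis

lemma padic_rel_seq_of:
  assumes "padic_cauchy CARD('p::prime_card) X"
  shows "padic_rel CARD('p) X (seq_of (Padic X :: 'p padic))"
  using assms seq_of[of "Padic X :: 'p padic"]
  by (simp add: padic_rel_def flip: Padic_eq_iff)

instantiation padic :: (prime_card) field
begin

definition "0 = (Padic (\<lambda>n. 0) :: 'a padic)"

definition "1 = (Padic (\<lambda>n. 1) :: 'a padic)"

definition "x + y = Padic (\<lambda>n. seq_of x n + seq_of y n)" for x y :: "'a padic"

definition "- x = Padic (\<lambda>n. - seq_of x n)" for x :: "'a padic"

definition "x * y = Padic (\<lambda>n. seq_of x n * seq_of y n)" for x y :: "'a padic"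

definition "inverse x = (if x = 0 then 0 else Padic (\<lambda>n. inverse (seq_of x n)))"
  for x :: "'a padic"

definition "x - y = x + - y" for x y :: "'a padic"

definition "x div y = x * inverse y" for x y :: "'a padic"

lemma Padic_eq_0_iff:
  "padic_cauchy CARD('a) X \<Longrightarrow> (Padic X :: 'a padic) = 0 \<longleftrightarrow> padic_vanishes CARD('a) X"
  by (simp add: zero_padic_def Padic_eq_iff prime_card)

lemma Padic_add:
  assumes "padic_cauchy CARD('a) X" "padic_cauchy CARD('a) Y"
  shows "(Padic X :: 'a padic) + Padic Y = Padic (\<lambda>n. X n + Y n)"
proof -
  have X: "padic_vanishes CARD('a) (\<lambda>n. seq_of (Padic X :: 'a padic) n - X n)"
    and Y: "padic_vanishes CARD('a) (\<lambda>n. seq_of (Padic Y :: 'a padic) n - Y n)"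
    using assms[THEN padic_rel_seq_of, THEN padic_rel_sym[OF prime_card]]
    by (simp_all add: padic_rel_def)
  show ?thesis
    unfolding plus_padic_def
    by (subst Padic_eq_iff)
      (simp_all add: assms seq_of prime_card add_diff_add padic_vanishes_add[OF _ X Y])
qed

lemma Padic_minus:
  assumes "padic_cauchy CARD('a) X"
  shows "- (Padic X :: 'a padic) = Padic (\<lambda>n. - X n)"
proof -
  have X: "padic_vanishes CARD('a) (\<lambda>n. seq_of (Padic X :: 'a padic) n - X n)"
    using assms[THEN padic_rel_seq_of, THEN padic_rel_sym[OF prime_card]]
    by (simp_all add: padic_rel_def)
  show ?thesis
    unfolding uminus_padic_def
    by (subst Padic_eq_iff)
      (simp_all only: assms seq_of prime_card minus_diff_minus padic_cauchy_minus
        padic_vanishes_minus[OF _ X])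
qed

lemma Padic_mult:
  assumes "padic_cauchy CARD('a) X" "padic_cauchy CARD('a) Y"
  shows "(Padic X :: 'a padic) * Padic Y = Padic (\<lambda>n. X n * Y n)"
proof -
  let ?X = "seq_of (Padic X :: 'a padic)" and ?Y = "seq_of (Padic Y :: 'a padic)"
  have X: "padic_vanishes CARD('a) (\<lambda>n. ?X n - X n)"
    and Y: "padic_vanishes CARD('a) (\<lambda>n. ?Y n - Y n)"
    using assms[THEN padic_rel_seq_of, THEN padic_rel_sym[OF prime_card]]
    by (simp_all add: padic_rel_def)
  have "padic_vanishes CARD('a) (\<lambda>n. ?X n * (?Y n - Y n) + Y n * (?X n - X n))"
    by (intro padic_vanishes_add padic_vanishes_mult_bounded padic_cauchy_bounded
        prime_card assms seq_of X Y)
  then have "padic_vanishes CARD('a) (\<lambda>n. ?X n * ?Y n - X n * Y n)"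
    by (simp add: mult_diff_mult mult.commute)
  then show ?thesis
    unfolding times_padic_def
    by (subst Padic_eq_iff) (simp_all add: assms seq_of prime_card)
qed

lemma Padic_inverse:
  assumes X: "padic_cauchy CARD('a) X" "\<not> padic_vanishes CARD('a) X"
  shows "inverse (Padic X :: 'a padic) = Padic (\<lambda>n. inverse (X n))"
proof -
  let ?X = "seq_of (Padic X :: 'a padic)"
  have rel: "padic_rel CARD('a) ?X X"
    by (rule padic_rel_sym[OF prime_card padic_rel_seq_of[OF X(1)]])
  then have v: "padic_cauchy CARD('a) ?X" "\<not> padic_vanishes CARD('a) ?X"
    "padic_vanishes CARD('a) (\<lambda>n. ?X n - X n)"
    using X padic_rel_vanishes_iff[OF prime_card rel] by (simp_all add: padic_rel_def)
  have "(Padic X :: 'a padic) \<noteq> 0" using X by (simp add: Padic_eq_0_iff)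
  then show ?thesis
    unfolding inverse_padic_def
    by (simp add: Padic_eq_iff X v prime_card padic_vanishes_diff_inverse)
qed

instance
proof
  fix a b c :: "'a padic"
  obtain X Y Z where X [simp]: "padic_cauchy CARD('a) X" "a = Padic X"
    and Y [simp]: "padic_cauchy CARD('a) Y" "b = Padic Y"
    and Z [simp]: "padic_cauchy CARD('a) Z" "c = Padic Z"
    by (meson Padic_cases)
  note [simp] = Padic_add Padic_mult Padic_minus prime_card
  show "a + b = b + a" by (simp add: ac_simps)
  show "(a + b) + c = a + (b + c)" by (simp add: ac_simps)
  show "0 + a = a" by (simp add: zero_padic_def)
  show "- a + a = 0" by (simp add: zero_padic_def)
  show "a - b = a + - b" by (rule minus_padic_def)
  show "(a * b) * c = a * (b * c)" by (simp add: ac_simps)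
  show "a * b = b * a" by (simp add: ac_simps)
  show "1 * a = a" by (simp add: one_padic_def)
  show "(a + b) * c = a * c + b * c" by (simp add: distrib_right)
  show "(0::'a padic) \<noteq> 1"
    by (simp add: zero_padic_def one_padic_def Padic_eq_iff)
  show "inverse a * a = 1" if "a \<noteq> 0"
  proof -
    have nv: "\<not> padic_vanishes CARD('a) X" using that by (simp add: Padic_eq_0_iff)
    obtain c N where "\<forall>n\<ge>N. rat_val CARD('a) (X n) = ereal c"
      by (rule padic_cauchy_not_vanishesE[OF prime_card X(1) nv])
    then have "\<forall>n\<ge>N. X n \<noteq> 0" by force
    then have "padic_vanishes CARD('a) (\<lambda>n. inverse (X n) * X n - 1)"
      unfolding padic_vanishes_def by (intro allI exI[of _ N]) simp
    then show ?thesis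
      by (simp add: one_padic_def Padic_inverse nv Padic_eq_iff)
  qed
  show "a div b = a * inverse b" by (rule divide_padic_def)
  show "inverse (0::'a padic) = 0" by (simp add: inverse_padic_def)
qed

end

lemma Padic_diff:
  assumes "padic_cauchy CARD('p::prime_card) X" "padic_cauchy CARD('p) Y"
  shows "(Padic X :: 'p padic) - Padic Y = Padic (\<lambda>n. X n - Y n)"
  using assms by (simp add: minus_padic_def Padic_minus Padic_add prime_card)

lemma of_int_padic: "(of_int k :: 'p::prime_card padic) = Padic (\<lambda>n. of_int k)"
proof -
  have nat: "(of_nat m :: 'p padic) = Padic (\<lambda>n. of_nat m)" for m
    by (induction m) (simp_all add: zero_padic_def one_padic_def Padic_add prime_card)
  show ?thesis
    by (cases k) (simp_all add: nat Padic_minus Padic_diff one_padic_def prime_card)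
qed

instance padic :: (prime_card) field_char_0
proof
  show "inj (of_nat :: nat \<Rightarrow> 'a padic)"
  proof (rule injI)
    fix m n :: nat
    assume "(of_nat m :: 'a padic) = of_nat n"
    then have "(of_int (int m - int n) :: 'a padic) = 0" by simp
    then show "m = n"
      unfolding of_int_padic by (simp add: Padic_eq_0_iff prime_card)
  qed
qed

lemma of_rat_padic: "(of_rat r :: 'p::prime_card padic) = Padic (\<lambda>n. r)"
proof -
  obtain a b where r: "r = of_int a / of_int b" "b \<noteq> 0"
    by (metis quotient_of_div quotient_of_denom_pos less_irrefl surj_pair)
  have "(of_int b :: 'p padic) * Padic (\<lambda>n. r) = of_int a"
    using r(2) by (simp add: of_int_padic Padic_mult prime_card r(1))
  then show ?thesis
    using r(2) by (simp add: r(1) of_rat_divide field_simps)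
qed


section \<open>Valuation and metric\<close>

text \<open>The sequence of valuations below is eventually constant if \<open>x \<noteq> 0\<close>, and it tends to
  infinity if \<open>x = 0\<close>.\<close>

definition padic_val :: "'p::prime_card padic \<Rightarrow> ereal" where
  "padic_val x = lim (\<lambda>n. rat_val CARD('p) (seq_of x n))"

lemma padic_val_Padic:
  assumes "padic_cauchy CARD('p::prime_card) X"
  shows "padic_val (Padic X :: 'p padic) = lim (\<lambda>n. rat_val CARD('p) (X n))"
  unfolding padic_val_def
  by (rule rat_val_lim_cong[OF prime_card padic_rel_seq_of[OF assms], symmetric])

lemma padic_val_of_rat: "padic_val (of_rat r :: 'p::prime_card padic) = rat_val CARD('p) r"
  by (simp add: of_rat_padic padic_val_Padic prime_card)

lemma padic_val_of_int:
  "k \<noteq> 0 \<Longrightarrow> padic_val (of_int k :: 'p::prime_card padic) = real (multiplicity (int CARD('p)) k)"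
  using padic_val_of_rat[of "of_int k", where 'p = 'p]
  by (simp add: rat_val_of_int prime_card)

lemma padic_val_tendsto:
  assumes X: "padic_cauchy CARD('p::prime_card) X"
  shows "(\<lambda>n. rat_val CARD('p) (X n)) \<longlonglongrightarrow> padic_val (Padic X :: 'p padic)"
proof -
  have "convergent (\<lambda>n. rat_val CARD('p) (X n))"
  proof (cases "padic_vanishes CARD('p) X")
    case True
    then show ?thesis using rat_val_tendsto_infty[OF prime_card] convergentI by blast
  next
    case False
    obtain c N where "\<forall>n\<ge>N. rat_val CARD('p) (X n) = ereal c"
      by (rule padic_cauchy_not_vanishesE[OF prime_card X False])
    then have "(\<lambda>n. rat_val CARD('p) (X n)) \<longlonglongrightarrow> ereal c"
      by (intro tendsto_eventually) (auto simp: eventually_sequentially)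
    then show ?thesis by (rule convergentI)
  qed
  then show ?thesis
    unfolding padic_val_Padic[OF X] by (simp add: convergent_LIMSEQ_iff)
qed

lemma padic_val_zero [simp]: "padic_val (0 :: 'p::prime_card padic) = \<infinity>"
  using padic_val_of_rat[of 0, where 'p = 'p] by simp

lemma padic_val_one [simp]: "padic_val (1 :: 'p::prime_card padic) = 0"
  using padic_val_of_rat[of 1, where 'p = 'p] by (simp add: prime_card)

lemma padic_val_finite:
  fixes x :: "'p::prime_card padic"
  assumes "x \<noteq> 0"
  obtains k :: int where "padic_val x = ereal (of_int k)"
proof -
  obtain X where X: "padic_cauchy CARD('p) X" "x = Padic X" by (rule Padic_cases)
  have nv: "\<not> padic_vanishes CARD('p) X" using assms X by (simp add: Padic_eq_0_iff)
  obtain c N where c: "\<forall>n\<ge>N. rat_val CARD('p) (X n) = ereal c"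
    by (rule padic_cauchy_not_vanishesE[OF prime_card X(1) nv])
  have "(\<lambda>n. rat_val CARD('p) (X n)) \<longlonglongrightarrow> ereal c"
    by (intro tendsto_eventually) (use c in \<open>auto simp: eventually_sequentially\<close>)
  then have "padic_val x = ereal c"
    using padic_val_tendsto[OF X(1)] X(2) LIMSEQ_unique by blast
  moreover obtain a b where "quotient_of (X N) = (a, b)" by fastforce
  then have "c = of_int (int (multiplicity (int CARD('p)) a) - int (multiplicity (int CARD('p)) b))"
    using c[rule_format, of N] by (simp add: rat_val_def split: if_splits)
  ultimately show ?thesis using that by blast
qed

lemma padic_val_eq_infty_iff [simp]: "padic_val x = \<infinity> \<longleftrightarrow> x = 0"
  by (metis PInfty_neq_ereal(1) padic_val_finite padic_val_zero)

lemma padic_val_mult: "padic_val (x * y) = padic_val x + padic_val y"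
proof (cases "x = 0 \<or> y = 0")
  case True
  then show ?thesis by auto
next
  case False
  obtain X where X: "padic_cauchy CARD('a) X" "x = Padic X" by (rule Padic_cases)
  obtain Y where Y: "padic_cauchy CARD('a) Y" "y = Padic Y" by (rule Padic_cases)
  have "(\<lambda>n. rat_val CARD('a) (X n) + rat_val CARD('a) (Y n)) \<longlonglongrightarrow> padic_val x + padic_val y"
    using False padic_val_tendsto[OF X(1)] padic_val_tendsto[OF Y(1)]
    by (intro tendsto_add_ereal) (auto simp: X(2) Y(2) elim: padic_val_finite)
  then have "(\<lambda>n. rat_val CARD('a) (X n * Y n)) \<longlonglongrightarrow> padic_val x + padic_val y"
    by (simp add: rat_val_mult prime_card)
  moreover have "(\<lambda>n. rat_val CARD('a) (X n * Y n)) \<longlonglongrightarrow> padic_val (x * y)"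
    using padic_val_tendsto[of "\<lambda>n. X n * Y n", where 'p = 'a] X Y
    by (simp add: Padic_mult prime_card)
  ultimately show ?thesis using LIMSEQ_unique by blast
qed

lemma padic_val_minus [simp]: "padic_val (- x) = padic_val x"
proof -
  obtain X where X: "padic_cauchy CARD('a) X" "x = Padic X" by (rule Padic_cases)
  then show ?thesis by (simp add: Padic_minus padic_val_Padic prime_card)
qed

lemma padic_val_add: "min (padic_val x) (padic_val y) \<le> padic_val (x + y)"
proof -
  obtain X where X: "padic_cauchy CARD('a) X" "x = Padic X" by (rule Padic_cases)
  obtain Y where Y: "padic_cauchy CARD('a) Y" "y = Padic Y" by (rule Padic_cases)
  have "(\<lambda>n. min (rat_val CARD('a) (X n)) (rat_val CARD('a) (Y n)))
      \<longlonglongrightarrow> min (padic_val x) (padic_val y)"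
    using padic_val_tendsto[OF X(1)] padic_val_tendsto[OF Y(1)] X(2) Y(2)
    by (intro tendsto_min) auto
  moreover have "(\<lambda>n. rat_val CARD('a) (X n + Y n)) \<longlonglongrightarrow> padic_val (x + y)"
    using padic_val_tendsto[of "\<lambda>n. X n + Y n", where 'p = 'a] X Y
    by (simp add: Padic_add prime_card)
  moreover have "min (rat_val CARD('a) (X n)) (rat_val CARD('a) (Y n)) \<le>
      rat_val CARD('a) (X n + Y n)" for n
    by (intro rat_val_add_ge prime_card) auto
  ultimately show ?thesis by (intro LIMSEQ_le) auto
qed

lemma padic_val_power:
  "padic_val x = ereal r \<Longrightarrow> padic_val (x ^ n) = ereal (real n * r)"
  by (induction n) (simp_all add: padic_val_mult zero_ereal_def algebra_simps)

lemma padic_val_add_ge: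
  "c \<le> padic_val x \<Longrightarrow> c \<le> padic_val y \<Longrightarrow> c \<le> padic_val (x + y)"
  by (meson min.boundedI order_trans padic_val_add)

lemma padic_val_diff_ge:
  "c \<le> padic_val x \<Longrightarrow> c \<le> padic_val y \<Longrightarrow> c \<le> padic_val (x - y)"
  using padic_val_add_ge[of c x "- y"] by simp

lemma padic_val_sum_ge:
  "finite A \<Longrightarrow> (\<And>i. i \<in> A \<Longrightarrow> c \<le> padic_val (f i)) \<Longrightarrow> c \<le> padic_val (sum f A)"
  by (induction A rule: finite_induct) (simp_all add: padic_val_add_ge)

instantiation padic :: (prime_card) metric_space
begin

definition dist_padic :: "'a padic \<Rightarrow> 'a padic \<Rightarrow> real" where
  "dist_padic x y =
    (if x = y then 0 else real CARD('a) powr (- real_of_ereal (padic_val (x - y))))"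

definition uniformity_padic :: "('a padic \<times> 'a padic) filter" where
  "uniformity_padic = (INF e\<in>{0<..}. principal {(x, y). dist x y < e})"

definition open_padic :: "'a padic set \<Rightarrow> bool" where
  "open_padic U \<longleftrightarrow> (\<forall>x\<in>U. eventually (\<lambda>(x', y). x' = x \<longrightarrow> y \<in> U) uniformity)"

lemma padic_dist_ultrametric:
  fixes x y z :: "'a padic"
  shows "dist x y \<le> max (dist x z) (dist y z)"
proof (cases "x = y \<or> x = z \<or> y = z")
  case True
  have commute: "dist u v = dist v u" for u v :: "'a padic"
    using padic_val_minus[of "u - v"] by (simp add: dist_padic_def)
  have nonneg: "0 \<le> dist u v" for u v :: "'a padic" by (simp add: dist_padic_def)
  show ?thesis
    using True
  proof (elim disjE)
    assume "x = y"
    then show ?thesis using nonneg by (simp add: dist_padic_def le_max_iff_disj)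
  next
    assume "x = z"
    then show ?thesis using commute[of x y] by simp
  qed simp
next
  case False
  obtain i j k :: int where ijk: "padic_val (x - y) = ereal i" "padic_val (x - z) = ereal j"
      "padic_val (y - z) = ereal k"
    using False padic_val_finite by (metis eq_iff_diff_eq_0)
  have "min (padic_val (x - z)) (padic_val (y - z)) \<le> padic_val ((x - z) - (y - z))"
    by (rule padic_val_diff_ge) auto
  then have "min j k \<le> i" using ijk by (auto simp: min_def split: if_splits)
  moreover have "CARD('a) > 1" by (rule prime_gt_1_nat) (rule prime_card)
  ultimately show ?thesis
    using False ijk by (auto simp: dist_padic_def le_max_iff_disj min_le_iff_disj)
qed

instance
proof
  fix x y z :: "'a padic"
  have pos: "CARD('a) > 0" by (rule prime_gt_0_nat) (rule prime_card)
  show "dist x y = 0 \<longleftrightarrow> x = y" using pos by (simp add: dist_padic_def)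
  have "0 \<le> dist u v" for u v :: "'a padic" by (simp add: dist_padic_def)
  then have "max (dist x z) (dist y z) \<le> dist x z + dist y z" by simp
  then show "dist x y \<le> dist x z + dist y z"
    using padic_dist_ultrametric[of x y z] by linarith
qed (simp_all add: uniformity_padic_def open_padic_def)

end

lemma padic_dist_less_iff:
  fixes x y :: "'p::prime_card padic"
  shows "dist x y < real CARD('p) powr (- k) \<longleftrightarrow> ereal k < padic_val (x - y)"
proof (cases "x = y")
  case False
  have p: "CARD('p) > 1" by (rule prime_gt_1_nat) (rule prime_card)
  obtain i :: int where "padic_val (x - y) = ereal i"
    using False padic_val_finite[of "x - y"] by auto
  then show ?thesis using False p by (simp add: dist_padic_def)
qed (auto simp: dist_padic_def intro: prime_gt_0_nat prime_card)

lemma padic_tendsto_iff: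
  fixes f :: "'b \<Rightarrow> 'p::prime_card padic"
  shows "(f \<longlongrightarrow> l) F \<longleftrightarrow> ((\<lambda>x. padic_val (f x - l)) \<longlongrightarrow> \<infinity>) F"
proof -
  have p: "real CARD('p) > 1" using prime_gt_1_nat[OF prime_card[where 'a = 'p]] by simp
  have "(f \<longlongrightarrow> l) F \<longleftrightarrow> (\<forall>k. \<forall>\<^sub>F x in F. dist (f x) l < real CARD('p) powr (- k))"
  proof
    assume "(f \<longlongrightarrow> l) F"
    then show "\<forall>k. \<forall>\<^sub>F x in F. dist (f x) l < real CARD('p) powr (- k)"
      using p by (intro allI tendstoD) simp_all
  next
    assume *: "\<forall>k. \<forall>\<^sub>F x in F. dist (f x) l < real CARD('p) powr (- k)"
    show "(f \<longlongrightarrow> l) F"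
    proof (rule tendstoI)
      fix e :: real
      assume "e > 0"
      then have "e = real CARD('p) powr (- (- log (real CARD('p)) e))" using p by simp
      then show "\<forall>\<^sub>F x in F. dist (f x) l < e" using * by metis
    qed
  qed
  then show ?thesis by (simp add: tendsto_PInfty padic_dist_less_iff)
qed


section \<open>Analytic functions\<close>

definition padic_ints :: "'p::prime_card padic set" where
  "padic_ints = {x. padic_val x \<ge> 0}"

definition has_power_series ::
    "('p::prime_card padic \<Rightarrow> 'p padic) \<Rightarrow> (nat \<Rightarrow> 'p padic) \<Rightarrow> bool" where
  "has_power_series F b \<longleftrightarrow>
    (\<forall>j. b j \<in> padic_ints) \<and>
    (\<lambda>j. padic_val (b j)) \<longlonglongrightarrow> \<infinity> \<and>
    (\<forall>x\<in>padic_ints. (\<lambda>j. b j * x ^ j) sums F x)"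

definition padic_analytic :: "('p::prime_card padic \<Rightarrow> 'p padic) \<Rightarrow> bool" where
  "padic_analytic F \<longleftrightarrow> F \<in> padic_ints \<rightarrow> padic_ints \<and> (\<exists>b. has_power_series F b)"

text \<open>The coefficients are determined by the function on \<open>padic_ints\<close>, which makes the
  definite description in \<open>power_series_coeff\<close> below meaningful.\<close>

lemma has_power_series_unique:
  fixes F :: "'p::prime_card padic \<Rightarrow> 'p padic"
  assumes b: "has_power_series F b" and b': "has_power_series F b'"
  shows "b = b'"
proof (rule ccontr)
  assume "b \<noteq> b'"
  define c where "c j = b j - b' j" for j
  define k where "k = (LEAST j. c j \<noteq> 0)"
  have "\<exists>j. c j \<noteq> 0" using \<open>b \<noteq> b'\<close> by (auto simp: c_def)
  then have ck: "c k \<noteq> 0" unfolding k_def by (rule LeastI_ex)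
  have c0: "c j = 0" if "j < k" for j using not_less_Least[of j "\<lambda>j. c j \<noteq> 0"] that by (simp add: k_def)
  have c_int: "0 \<le> padic_val (c j)" for j
    using b b' unfolding c_def
    by (intro padic_val_diff_ge) (simp_all add: has_power_series_def padic_ints_def)
  obtain i :: int where i: "padic_val (c k) = ereal i" using ck by (rule padic_val_finite)
  define m where "m = nat (\<bar>i\<bar> + 1)"
  define x :: "'p padic" where "x = of_int (int CARD('p)) ^ m"
  have p: "CARD('p) > 1" by (rule prime_gt_1_nat) (rule prime_card)
  have "padic_val (of_int (int CARD('p)) :: 'p padic) =
      ereal (real (multiplicity (int CARD('p)) (int CARD('p))))"
    using p by (intro padic_val_of_int) simp
  also have "multiplicity (int CARD('p)) (int CARD('p)) = 1"
    by (rule multiplicity_prime) (rule prime_elem_int_p[OF prime_card])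
  finally have "padic_val (of_int (int CARD('p)) :: 'p padic) = ereal 1" by simp
  from padic_val_power[OF this, of m] have x: "padic_val x = ereal (real m)"
    by (simp add: x_def)
  then have "x \<in> padic_ints" by (simp add: padic_ints_def)
  then have S: "(\<lambda>j. b j * x ^ j) sums F x" "(\<lambda>j. b' j * x ^ j) sums F x"
    using b b' by (auto simp: has_power_series_def)
  define K where "K = real (Suc k) * real m"
  define S where "S n = (\<Sum>j<n. b j * x ^ j)" for n
  define S' where "S' n = (\<Sum>j<n. b' j * x ^ j)" for n
  have "\<forall>\<^sub>F n in sequentially. ereal K < padic_val (S n - F x)"
    "\<forall>\<^sub>F n in sequentially. ereal K < padic_val (S' n - F x)"
    using S by (simp_all only: sums_def padic_tendsto_iff tendsto_PInfty S_def S'_def)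
  then have "\<forall>\<^sub>F n in sequentially. ereal K < padic_val (S n - F x) \<and>
      ereal K < padic_val (S' n - F x) \<and> n > k"
    by (intro eventually_conj eventually_gt_at_top)
  from eventually_happens'[OF sequentially_bot this]
  obtain n where n: "ereal K < padic_val (S n - F x)" "ereal K < padic_val (S' n - F x)" "n > k"
    by blast
  have "ereal K \<le> padic_val ((S n - F x) - (S' n - F x))"
    using n by (intro padic_val_diff_ge less_imp_le)
  also have "(S n - F x) - (S' n - F x) = (\<Sum>j<n. c j * x ^ j)"
    by (simp add: S_def S'_def c_def left_diff_distrib sum_subtractf)
  finally have total: "ereal K \<le> padic_val (\<Sum>j<n. c j * x ^ j)" .
  have rest: "ereal K \<le> padic_val (\<Sum>j\<in>{..<n} - {k}. c j * x ^ j)"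
  proof (rule padic_val_sum_ge)
    fix j assume j: "j \<in> {..<n} - {k}"
    show "ereal K \<le> padic_val (c j * x ^ j)"
    proof (cases "j < k")
      case True
      then show ?thesis by (simp add: c0)
    next
      case False
      then have "Suc k \<le> j" using j by auto
      then have "K \<le> real j * real m" unfolding K_def by (intro mult_right_mono) auto
      then have "0 + ereal K \<le> padic_val (c j) + ereal (real j * real m)"
        using c_int by (intro add_mono) auto
      then show ?thesis by (simp add: padic_val_mult padic_val_power[OF x])
    qed
  qed simp
  have "(\<Sum>j<n. c j * x ^ j) = c k * x ^ k + (\<Sum>j\<in>{..<n} - {k}. c j * x ^ j)"
    using n(3) by (intro sum.remove) auto
  then have "(\<Sum>j<n. c j * x ^ j) - (\<Sum>j\<in>{..<n} - {k}. c j * x ^ j) = c k * x ^ k"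
    by simp
  with padic_val_diff_ge[OF total rest] have "ereal K \<le> padic_val (c k * x ^ k)" by simp
  then have "K \<le> of_int i + real k * real m"
    by (simp add: padic_val_mult i padic_val_power[OF x])
  then have "real m \<le> of_int i" by (simp add: K_def algebra_simps)
  moreover have "real m = \<bar>of_int i\<bar> + 1" by (simp add: m_def)
  ultimately show False by linarith
qed

definition power_series_coeff :: "('p::prime_card padic \<Rightarrow> 'p padic) \<Rightarrow> nat \<Rightarrow> 'p padic" where
  "power_series_coeff F = (THE b. has_power_series F b)"

lemma power_series_coeff_eq: "has_power_series F b \<Longrightarrow> power_series_coeff F = b"
  unfolding power_series_coeff_def by (blast intro: the_equality has_power_series_unique)

text \<open>The infimum and the greatest index in the next two definitions are attained when \<open>F\<close> is
  analytic and non-zero, by the lemma that follows them.\<close>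

definition min_coeff_val :: "('p::prime_card padic \<Rightarrow> 'p padic) \<Rightarrow> ereal" where
  "min_coeff_val F = (INF j. padic_val (power_series_coeff F j))"

definition last_min_index :: "('p::prime_card padic \<Rightarrow> 'p padic) \<Rightarrow> nat" where
  "last_min_index F = (GREATEST j. padic_val (power_series_coeff F j) = min_coeff_val F)"

lemma min_coeff_val_attained:
  assumes F: "padic_analytic F" and nz: "\<exists>x\<in>padic_ints. F x \<noteq> 0"
  shows "min_coeff_val F \<in> range (\<lambda>j. padic_val (power_series_coeff F j))"
    and "finite {j. padic_val (power_series_coeff F j) = min_coeff_val F}"
proof -
  obtain b where b: "has_power_series F b" using F by (auto simp: padic_analytic_def)
  note coeff = power_series_coeff_eq[OF b]
  have "\<exists>j. b j \<noteq> 0"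
  proof (rule ccontr)
    assume "\<nexists>j. b j \<noteq> 0"
    then have "(\<lambda>j. 0) sums F x" if "x \<in> padic_ints" for x
      using b that by (simp add: has_power_series_def)
    then show False using nz sums_0 sums_unique2 by metis
  qed
  then obtain i where i: "b i \<noteq> 0" ..
  obtain v :: int where v: "padic_val (b i) = ereal v" using i by (rule padic_val_finite)
  obtain N where N: "\<And>j. j \<ge> N \<Longrightarrow> ereal v < padic_val (b j)"
    using b unfolding has_power_series_def tendsto_PInfty eventually_sequentially by blast
  define A where "A = (\<lambda>j. padic_val (b j)) ` {..max N i}"
  have A: "finite A" "A \<noteq> {}" by (auto simp: A_def)
  have Min_v: "Min A \<le> ereal v"
    unfolding v[symmetric] using A by (intro Min_le) (auto simp: A_def)
  have "Min A \<le> padic_val (b j)" for j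
  proof (cases "j \<le> max N i")
    case True
    then show ?thesis using A by (intro Min_le) (auto simp: A_def)
  next
    case False
    then have "ereal v < padic_val (b j)" by (intro N) simp
    then show ?thesis by (rule order_trans[OF Min_v less_imp_le])
  qed
  moreover obtain j where j: "Min A = padic_val (b j)"
    using Min_in[OF A] unfolding A_def by (elim imageE)
  ultimately have eq: "min_coeff_val F = Min A"
    unfolding min_coeff_val_def coeff by (intro antisym INF_greatest) (auto intro: INF_lower)
  then show "min_coeff_val F \<in> range (\<lambda>j. padic_val (power_series_coeff F j))"
    using j by (simp add: coeff)
  have "{j. padic_val (power_series_coeff F j) = min_coeff_val F} \<subseteq> {..N}"
  proof
    fix j assume "j \<in> {j. padic_val (power_series_coeff F j) = min_coeff_val F}"
    then have "padic_val (b j) \<le> ereal v" using Min_v by (simp add: coeff eq)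
    then show "j \<in> {..N}" using N[of j] by (cases "j \<le> N") auto
  qed
  then show "finite {j. padic_val (power_series_coeff F j) = min_coeff_val F}"
    by (rule finite_subset) simp
qed

definition fwd_diff :: "('a::ring_1 \<Rightarrow> 'a) \<Rightarrow> 'a \<Rightarrow> 'a" where
  "fwd_diff F x = F (x + 1) - F x"

end

theory Submission
  imports "HOL-Number_Theory.Residues" "HOL-Real_Asymp.Real_Asymp" "Jordan_Normal_Form.Char_Poly" Defs
begin

text \<open>
  Let \<open>f\<close> be the characteristic polynomial of the recurrence. As \<open>x\<close> is a unit modulo
  \<open>(p, f)\<close>, some \<open>M\<close> satisfies \<open>x\<^sup>M = 1 + p g\<close> modulo \<open>f\<close>. Applying the functional
  \<open>x\<^sup>i \<mapsto> u\<^sub>i\<^sub>+\<^sub>l\<close>, which kills the multiples of \<open>f\<close>, to \<open>(1 + p g)\<^sup>n\<close> gives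
  \<open>u (M n + l) = (\<Sum>k. (n choose k) p\<^sup>k w\<^sub>k)\<close>, where \<open>w\<^sub>k\<close> is the image of \<open>g\<^sup>k\<close>. So
  \<open>(\<Delta>\<^sup>k F) 0 = p\<^sup>k w\<^sub>k\<close>, and by Cayley-Hamilton \<open>w\<close> satisfies an integral recurrence of
  order \<open>d\<close>. By Legendre's bound on the valuation of \<open>k!\<close>, the coefficients
  \<open>p\<^sup>k w\<^sub>k / k!\<close> of the expansion of \<open>F\<close> in falling factorials have, for \<open>k \<ge> d\<close>, valuation
  larger than the minimum over \<open>k < d\<close>, and for \<open>k < d\<close> the same valuation as \<open>(\<Delta>\<^sup>k F) 0\<close>.
  The passage from falling factorials to monomials is integral and unitriangular, so it preserves
  the minimal valuation and the last index where it is attained.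
\<close>

section \<open>Integer polynomials modulo a monic polynomial\<close>

text \<open>A monic divisor permits long division over any commutative ring. Vanishing coefficients,
  unlike a strict degree bound, also describe the zero remainder left by a constant
  \<open>f\<close>.\<close>

lemma monic_reduce:
  fixes f h :: "'a::comm_ring_1 poly"
  assumes "lead_coeff f = 1"
  shows "\<exists>r. f dvd h - r \<and> (\<forall>i\<ge>degree f. coeff r i = 0)"
proof (induction "degree h" arbitrary: h rule: less_induct)
  case less
  show ?case
  proof (cases "degree h < degree f \<or> h = 0")
    case True
    then show ?thesis by (intro exI[of _ h]) (auto intro: coeff_eq_0)
  next
    case False
    define k where "k = degree h - degree f"
    have k: "degree h = k + degree f" using False by (simp add: k_def)
    define t where "t = monom (lead_coeff h) k"
    define h' where "h' = h - f * t"
    have coeff_ft: "coeff (f * t) i = (if i < k then 0 else coeff f (i - k) * lead_coeff h)" for i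
      by (simp add: t_def coeff_monom_mult mult.commute[of f])
    have h': "coeff h' i = 0" if "i \<ge> degree h" for i
    proof (cases "i = degree h")
      case True
      then show ?thesis using assms by (simp add: h'_def coeff_ft k)
    next
      case False
      then have "i > degree h" "i - k > degree f" using that k by auto
      then show ?thesis using k by (simp add: h'_def coeff_ft coeff_eq_0)
    qed
    show ?thesis
    proof (cases "degree h' < degree h")
      case True
      then obtain r where r: "f dvd h' - r" "\<forall>i\<ge>degree f. coeff r i = 0" using less by blast
      have "f dvd (h' - r) + f * t" using r by (intro dvd_add) auto
      then show ?thesis using r(2) by (intro exI[of _ r]) (simp add: h'_def)
    next
      case False
      \<comment> \<open>The degree can fail to drop only when \<open>h\<close> is constant, and then
        nothing remains.\<close>
      then have "lead_coeff h' = 0" using h' by simp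
      then have "h' = 0" by simp
      then have "f dvd h - 0" by (simp add: h'_def)
      then show ?thesis by (intro exI[of _ 0]) simp
    qed
  qed
qed

text \<open>Multiplication by \<open>g\<close> acts on the free module of residues modulo
  \<open>f\<close>, and \<open>q\<close> is the characteristic polynomial of its matrix. That
  \<open>q\<close> is monic of the same degree later gives the powers of \<open>g\<close> a
  recurrence of unchanged order.\<close>

lemma Cayley_Hamilton_quotient:
  fixes f g :: "'a::comm_ring_1 poly"
  assumes f: "lead_coeff f = 1" and d: "degree f > 0"
  shows "\<exists>q. lead_coeff q = 1 \<and> degree q = degree f \<and> f dvd q \<circ>\<^sub>p g"
proof -
  define n where "n = degree f"
  text \<open>Row \<open>i\<close> of \<open>B\<close> is \<open>g x\<^sup>i\<close> reduced modulo \<open>f\<close>, so \<open>N = g I - B\<close> sends the vector of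
    powers of \<open>x\<close> to zero modulo \<open>f\<close>; multiply by the adjugate of \<open>N\<close>.\<close>
  have "\<exists>r. f dvd g * monom 1 i - r \<and> (\<forall>j\<ge>n. coeff r j = 0)" for i
    using monic_reduce[OF f] by (simp add: n_def)
  then obtain r where r: "\<And>i. f dvd g * monom 1 i - r i" "\<And>i j. j \<ge> n \<Longrightarrow> coeff (r i) j = 0"
    by metis
  define B where "B = Matrix.mat n n (\<lambda>(i, j). coeff (r i) j)"
  define N where "N = Matrix.mat n n (\<lambda>(i, j). (if i = j then g else 0) - [:coeff (r i) j:])"
  have B: "B \<in> carrier_mat n n" and N: "N \<in> carrier_mat n n" by (auto simp: B_def N_def)
  interpret lift: comm_ring_hom "\<lambda>c::'a. [:c:]" by unfold_locales auto
  \<comment> \<open>Evaluation at \<open>g\<close> commutes with the determinant once the entries of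
    \<open>B\<close> are lifted to constant polynomials.\<close>
  have "poly (char_poly (map_mat (\<lambda>c. [:c:]) B)) g = Determinant.det N"
    unfolding char_poly_def
    by (rule poly_det_cong[OF N]) (auto simp: B_def N_def char_poly_matrix_def)
  then have "Determinant.det N = char_poly B \<circ>\<^sub>p g"
    by (simp add: lift.char_poly_hom[OF B] pcompose_altdef)
  moreover have "f dvd Determinant.det N"
  proof -
    have row: "f dvd (\<Sum>j<n. N $$ (k, j) * monom 1 j)" if k: "k < n" for k
    proof -
      have "r k = (\<Sum>j<n. monom (coeff (r k) j) j)"
        by (rule poly_eqI) (auto simp: coeff_sum r(2) not_less)
      moreover have "(\<Sum>j<n. N $$ (k, j) * monom 1 j) =
          (\<Sum>j<n. (if k = j then g * monom 1 j else 0) - monom (coeff (r k) j) j)"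
        using k by (intro sum.cong) (auto simp: N_def left_diff_distrib smult_monom)
      ultimately have "(\<Sum>j<n. N $$ (k, j) * monom 1 j) = g * monom 1 k - r k"
        using k by (simp add: sum_subtractf)
      then show ?thesis using r(1) by simp
    qed
    have "(adj_mat N * N) $$ (0, j) = (if j = 0 then Determinant.det N else 0)" if "j < n" for j
      using d that by (simp add: adj_mat(3)[OF N] n_def)
    moreover have "(adj_mat N * N) $$ (0, j) = (\<Sum>k<n. adj_mat N $$ (0, k) * N $$ (k, j))"
      if "j < n" for j
      using d that N adj_mat(1)[OF N]
      by (auto simp: times_mat_def scalar_prod_def n_def atLeast0LessThan intro!: sum.cong)
    ultimately have "Determinant.det N = (\<Sum>j<n. (\<Sum>k<n. adj_mat N $$ (0, k) * N $$ (k, j)) * monom 1 j)"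
      using d by (simp add: n_def if_distrib[of "\<lambda>x. x * _"] cong: if_cong)
    also have "\<dots> = (\<Sum>k<n. adj_mat N $$ (0, k) * (\<Sum>j<n. N $$ (k, j) * monom 1 j))"
      unfolding sum_distrib_left sum_distrib_right by (subst sum.swap) (simp add: mult.assoc)
    also have "f dvd \<dots>" by (rule dvd_sum, rule dvd_mult, rule row) simp
    finally show ?thesis .
  qed
  ultimately show ?thesis
    using degree_monic_char_poly[OF B] by (intro exI[of _ "char_poly B"]) (simp add: n_def)
qed


text \<open>The powers of x repeat in the finite ring of residues modulo \<open>(p, f)\<close>, and
  a unit can be cancelled from a repetition. In degree one, Fermat's little theorem supplies
  \<open>M = p - 1\<close>.\<close>

lemma power_cong_one_mod_poly:
  fixes f :: "int poly"
  assumes f: "lead_coeff f = 1" and d: "degree f > 0"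
    and p: "prime p" "\<not> int p dvd coeff f 0"
  shows "\<exists>M g. 0 < M \<and> M < p ^ (degree f)\<^sup>2 \<and> f dvd monom 1 M - 1 - [:int p:] * g"
proof -
  define d where "d = degree f"
  define P :: "int poly" where "P = [:int p:]"
  have p1: "p > 1" using p(1) by (rule prime_gt_1_nat)
  show ?thesis
  proof (cases "d = 1")
    case True
    define a where "a = - coeff f 0"
    have "f = [:- a, 1:]"
      using f True by (intro poly_eqI) (auto simp: coeff_pCons a_def d_def coeff_eq_0 split: nat.splits)
    then have f': "monom 1 1 - [:a:] = f" by (simp add: monom_altdef)
    have "\<not> int p dvd a" using p by (simp add: a_def)
    then have "[a ^ (p - 1) = 1] (mod int p)"
    proof -
      have b: "int (nat (a mod int p)) = a mod int p" using p1 by simp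
      then have "\<not> p dvd nat (a mod int p)"
        using \<open>\<not> int p dvd a\<close> by (metis dvd_mod_iff dvd_refl int_dvd_int_iff)
      from fermat_theorem[OF p(1) this]
      have "[int (nat (a mod int p) ^ (p - 1)) = int 1] (mod int p)" unfolding cong_int_iff .
      then have "[(a mod int p) ^ (p - 1) = 1] (mod int p)" by (simp only: of_nat_power b of_nat_1)
      then show ?thesis by (simp add: Cong.cong_def power_mod)
    qed
    then obtain c where c: "a ^ (p - 1) - 1 = int p * c" by (auto simp: cong_iff_dvd_diff)
    \<comment> \<open>Both terms are powers with exponent \<open>p - 1\<close>, so
      \<open>x - a\<close>, which is \<open>f\<close>, divides their difference.\<close>
    have "monom 1 (p - 1) - [:a ^ (p - 1):] = (monom 1 1) ^ (p - 1) - [:a:] ^ (p - 1)"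
      by (simp add: poly_const_pow monom_power)
    also have "f dvd \<dots>" unfolding power_diff_sumr2 f' by (rule dvd_triv_left)
    also have "a ^ (p - 1) = 1 + int p * c" using c by (simp only: diff_eq_eq add.commute)
    also have "[:1 + int p * c:] = 1 + P * [:c:]" by (simp add: P_def one_pCons)
    finally have "f dvd monom 1 (p - 1) - 1 - P * [:c:]" by (simp add: algebra_simps)
    then show ?thesis
      using p1 True by (intro exI[of _ "p - 1"] exI[of _ "[:c:]"]) (auto simp: d_def P_def)
  next
    case False
    then have d2: "d \<ge> 2" using d by (simp add: d_def)
    text \<open>The \<open>p ^ d + 1\<close> powers up to \<open>x ^ (p ^ d)\<close> have only \<open>p ^ d\<close> reductions modulo
      \<open>(p, f)\<close>. For \<open>d = 1\<close> this pigeonhole bound would not be good enough.\<close>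
    define I where "I h \<longleftrightarrow> (\<exists>g. f dvd h - P * g)" for h
    obtain h where h: "f = pCons (coeff f 0) h"
      by (metis coeff_pCons_0 pCons_cases)
    define X :: "int poly" where "X = monom 1 1"
    define A where "A = [:coeff f 0:]"
    have fX: "f = A + X * h" unfolding A_def by (subst h) (simp add: X_def monom_altdef)
    have "coprime (coeff f 0) (int p)"
      using p by (simp add: prime_imp_coprime coprime_commute)
    then obtain b where "[coeff f 0 * b = 1] (mod int p)"
      using cong_solve_coprime_int by blast
    then obtain c where c: "coeff f 0 * b = 1 + int p * c"
      by (metis cong_iff_lin cong_sym)
    define B C where "B = [:b:]" and "C = [:c:]"
    have "A * B = [:coeff f 0 * b:]" by (simp add: A_def B_def)
    also have "\<dots> = 1 + P * C" unfolding c by (simp add: P_def C_def one_pCons)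
    finally have AB: "A * B = 1 + P * C" .
    \<comment> \<open>Multiplying \<open>f = A + X * h\<close> by \<open>B\<close> shows that
      \<open>- B * h\<close> inverts \<open>X\<close> modulo \<open>(p, f)\<close>. The computation
      carries the witnesses along.\<close>
    have cancel: "I g" if I_Xg: "I (X * g)" for g
    proof -
      obtain s where "f dvd X * g - P * s" using I_Xg unfolding I_def by blast
      then obtain t where t: "X * g - P * s = f * t" by (elim dvdE)
      have "f * (B * g - B * h * t) = f * (B * g) - B * h * (f * t)"
        by (simp add: algebra_simps)
      also have "\<dots> = (A + X * h) * (B * g) - B * h * (X * g - P * s)"
        by (simp only: t flip: fX)
      also have "\<dots> = (A * B) * g + P * (B * h * s)" by (simp add: algebra_simps)
      also have "\<dots> = g - P * (- B * h * s - C * g)" unfolding AB by (simp add: algebra_simps)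
      finally have "g - P * (- B * h * s - C * g) = f * (B * g - B * h * t)" by simp
      then show ?thesis unfolding I_def by (metis dvd_triv_left)
    qed
    have cancel_power: "I g" if "I (X ^ i * g)" for i g
      using that by (induction i) (auto simp: mult.assoc dest: cancel)
    have "\<forall>n. \<exists>r. f dvd X ^ n - r \<and> (\<forall>i\<ge>d. coeff r i = 0)"
      using monic_reduce[OF f] unfolding d_def by blast
    then obtain r where r: "\<And>n. f dvd X ^ n - r n" "\<And>n i. i \<ge> d \<Longrightarrow> coeff (r n) i = 0"
      by metis
    \<comment> \<open>The residues modulo \<open>p\<close> of the reduced \<open>X ^ n\<close>;
      restriction to \<open>{..<d}\<close> puts them in a function space with \<open>p ^ d\<close>
      elements.\<close>
    define key where "key n = (\<lambda>i\<in>{..<d}. coeff (r n) i mod int p)" for n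
    have "key ` {0..p ^ d} \<subseteq> {..<d} \<rightarrow>\<^sub>E {0..<int p}"
      unfolding key_def using p1 by (intro image_subsetI restrict_PiE_iff[THEN iffD2]) simp
    from card_mono[OF _ this] have "card (key ` {0..p ^ d}) \<le> p ^ d"
      by (simp add: finite_PiE card_PiE)
    then have "\<not> inj_on key {0..p ^ d}" using card_image[of key "{0..p ^ d}"] by auto
    then obtain i j where ij: "i < j" "j \<le> p ^ d" "key i = key j"
      unfolding inj_on_def by (metis atLeastAtMost_iff linorder_neqE_nat)
    have "int p dvd coeff (r j - r i) k" for k
    proof (cases "k < d")
      case True
      then have "coeff (r i) k mod int p = coeff (r j) k mod int p"
        using fun_cong[OF ij(3), of k] by (simp add: key_def)
      then show ?thesis by (metis coeff_diff mod_eq_dvd_iff)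
    qed (simp add: r(2))
    then have "P dvd r j - r i" by (simp add: P_def const_poly_dvd_iff)
    then obtain s where s: "r j - r i = P * s" by (elim dvdE)
    have "f dvd (X ^ j - r j) - (X ^ i - r i)" by (intro dvd_diff r)
    also have "(X ^ j - r j) - (X ^ i - r i) = X ^ i * (X ^ (j - i) - 1) - P * s"
      using ij(1) s by (simp add: algebra_simps flip: power_add)
    finally have "I (X ^ i * (X ^ (j - i) - 1))" unfolding I_def by blast
    then have "I (X ^ (j - i) - 1)" by (rule cancel_power)
    moreover have "j - i < p ^ d\<^sup>2"
    proof -
      have "j - i \<le> p ^ d" using ij by simp
      also have "\<dots> < p ^ d\<^sup>2" using p1 d2 by (simp add: power2_eq_square)
      finally show ?thesis .
    qed
    ultimately obtain g where "j - i < p ^ d\<^sup>2" "f dvd monom 1 (j - i) - 1 - [:int p:] * g"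
      unfolding I_def by (auto simp: X_def monom_power P_def)
    then show ?thesis using ij(1) unfolding d_def by (intro exI[of _ "j - i"] exI[of _ g]) simp
  qed
qed

section \<open>Linear recurrences as functionals on polynomials\<close>

text \<open>Keeping the offset \<open>l\<close> as a parameter turns multiplication by x into the
  step from \<open>l\<close> to \<open>Suc l\<close>.\<close>

definition shift_functional :: "(nat \<Rightarrow> 'a::comm_ring_1) \<Rightarrow> nat \<Rightarrow> 'a poly \<Rightarrow> 'a" where
  "shift_functional u l h = (\<Sum>i\<le>degree h. coeff h i * u (i + l))"

lemma shift_functional_bound:
  "degree h \<le> n \<Longrightarrow> shift_functional u l h = (\<Sum>i\<le>n. coeff h i * u (i + l))"
  unfolding shift_functional_def by (intro sum.mono_neutral_left) (auto intro: le_degree)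

section \<open>Linearity of the functional and its behaviour under multiplication by x\<close>

lemma shift_functional_add:
  "shift_functional u l (g + h) = shift_functional u l g + shift_functional u l h"
proof -
  define n where "n = max (degree g) (degree h)"
  have "degree (g + h) \<le> n" by (simp add: n_def degree_add_le_max)
  then show ?thesis
    by (simp add: shift_functional_bound[of _ n] n_def sum.distrib distrib_right)
qed

lemma shift_functional_smult:
  "shift_functional u l (smult c h) = c * shift_functional u l h"
  using degree_smult_le[of c h]
  by (simp add: shift_functional_bound[of _ "degree h"] sum_distrib_left mult.assoc)

lemma shift_functional_0 [simp]: "shift_functional u l 0 = 0"
  by (simp add: shift_functional_def)

lemma shift_functional_sum:
  "shift_functional u l (sum g A) = (\<Sum>i\<in>A. shift_functional u l (g i))"
  by (induction A rule: infinite_finite_induct) (simp_all add: shift_functional_add)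

lemma shift_functional_monom: "shift_functional u l (monom c n) = c * u (n + l)"
  by (simp add: shift_functional_bound[of _ n] degree_monom_le if_distrib[of "\<lambda>x. x * _"] cong: if_cong)

lemma shift_functional_pCons:
  "shift_functional u l (pCons c h) = c * u l + shift_functional u (Suc l) h"
  by (simp add: shift_functional_bound[of _ "Suc (degree h)"] degree_pCons_le
      sum.atMost_Suc_shift shift_functional_def del: sum.atMost_Suc)

text \<open>The common kernel for all offsets is an ideal, because multiplication by x only moves
  the offset. Hence \<open>l\<close> is arbitrary in the induction.\<close>

lemma shift_functional_dvd_eq_0:
  assumes f: "\<And>l. shift_functional u l f = 0" and "f dvd h"
  shows "shift_functional u l h = 0"
proof -
  have "shift_functional u l (f * t) = 0" for t
    by (induction t arbitrary: l)
      (simp_all add: shift_functional_add shift_functional_smult shift_functional_pCons f)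
  then show ?thesis using assms(2) by auto
qed

text \<open>\<open>M\<close> and \<open>c\<close> are fixed before \<open>l\<close>; only
  \<open>w\<close> depends on the residue class. The factor \<open>int p ^ k\<close> stays outside
  \<open>w\<close>, which then satisfies an integral recurrence.\<close>

lemma linear_recurrence_interpolation:
  fixes u a :: "nat \<Rightarrow> int"
  assumes d: "d \<ge> 1" and rec: "\<And>n. u (n + d) = (\<Sum>i<d. a i * u (n + i))"
    and p: "prime p" "\<not> int p dvd a 0"
  obtains M c where "0 < M" "M < p ^ d\<^sup>2"
    "\<And>l. \<exists>w. (\<forall>n. u (M * n + l) = (\<Sum>k\<le>n. int (n choose k) * (int p ^ k * w k))) \<and>
      (\<forall>k. w (k + d) = (\<Sum>i<d. c i * w (k + i)))"
proof -
  define f where "f = monom 1 d - (\<Sum>i<d. monom (a i) i)"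
  have coeff_f: "coeff f i = (if i = d then 1 else if i < d then - a i else 0)" for i
    by (auto simp: f_def coeff_sum)
  have deg: "degree f = d"
    by (rule antisym) (auto intro: degree_le le_degree simp: coeff_f)
  have lc: "lead_coeff f = 1" by (simp add: deg coeff_f)
  have f0: "shift_functional u l f = 0" for l
  proof -
    have "shift_functional u l f = u (d + l) + (\<Sum>i<d. - a i * u (i + l))"
      by (simp add: shift_functional_def deg coeff_f flip: lessThan_Suc_atMost)
    then show ?thesis using rec[of l] by (simp add: sum_negf add.commute)
  qed
  have phi_cong: "shift_functional u l g = shift_functional u l h" if "f dvd g - h" for l g h
    using shift_functional_dvd_eq_0[OF f0 that, of l] shift_functional_add[of u l "g - h" h] by simp
  obtain M g where M: "0 < M" "M < p ^ d\<^sup>2" and g: "f dvd monom 1 M - 1 - [:int p:] * g"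
    using power_cong_one_mod_poly[OF lc _ p(1)] d p(2) by (auto simp: deg coeff_f)
  obtain q where q: "lead_coeff q = 1" "degree q = d" "f dvd q \<circ>\<^sub>p g"
    using Cayley_Hamilton_quotient[OF lc, of g] d by (auto simp: deg)
  define w where "w l k = shift_functional u l (g ^ k)" for l k
  show ?thesis
  proof
    fix l
    have "u (M * n + l) = (\<Sum>k\<le>n. int (n choose k) * (int p ^ k * w l k))" for n
    proof -
      have "f dvd monom 1 M - (1 + [:int p:] * g)" using g by (simp add: algebra_simps)
      then have "f dvd monom 1 M ^ n - (1 + [:int p:] * g) ^ n"
        unfolding power_diff_sumr2 by (rule dvd_mult2)
      then have "shift_functional u l (monom 1 (M * n)) =
          shift_functional u l (([:int p:] * g + 1) ^ n)"
        by (intro phi_cong) (simp add: monom_power mult.commute add.commute)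
      also have "([:int p:] * g + 1) ^ n = (\<Sum>k\<le>n. smult (int (n choose k) * int p ^ k) (g ^ k))"
        by (simp add: binomial_ring of_nat_poly smult_power mult.commute)
      also have "shift_functional u l \<dots> = (\<Sum>k\<le>n. int (n choose k) * (int p ^ k * w l k))"
        by (simp add: shift_functional_sum shift_functional_smult w_def mult.assoc)
      finally show ?thesis by (simp add: shift_functional_monom)
    qed
    moreover have "w l (k + d) = (\<Sum>i<d. - coeff q i * w l (k + i))" for k
    proof -
      have deg_map: "degree (map_poly (\<lambda>x. [:x:]) q) = d" using q(2) by (subst degree_map_poly) auto
      \<comment> \<open>This multiple of \<open>f\<close> is killed by the functional; since
        \<open>q\<close> is monic, the resulting relation can be solved for the term
        \<open>w l (k + d)\<close>.\<close>
      have "q \<circ>\<^sub>p g * g ^ k = (\<Sum>i\<le>d. smult (coeff q i) (g ^ (k + i)))"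
        by (simp add: pcompose_altdef poly_altdef deg_map sum_distrib_left
            sum_distrib_right power_add mult_ac coeff_map_poly)
      moreover have "shift_functional u l (q \<circ>\<^sub>p g * g ^ k) = 0"
        using q(3) by (intro shift_functional_dvd_eq_0[OF f0]) simp
      ultimately have "(\<Sum>i\<le>d. coeff q i * w l (k + i)) = 0"
        by (simp add: shift_functional_sum shift_functional_smult w_def)
      then show ?thesis using q(1,2)
        by (simp add: sum_negf eq_neg_iff_add_eq_0 add.commute flip: lessThan_Suc_atMost)
    qed
    ultimately show "\<exists>w. (\<forall>n. u (M * n + l) = (\<Sum>k\<le>n. int (n choose k) * (int p ^ k * w k))) \<and>
      (\<forall>k. w (k + d) = (\<Sum>i<d. - coeff q i * w (k + i)))" by (intro exI[of _ "w l"]) simp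
  qed (use M in auto)
qed

section \<open>Valuations and completeness\<close>

text \<open>A consequence of Legendre's formula, by strong induction: if
  \<open>k = p * n + r\<close> with \<open>r < p\<close>, then \<open>k!\<close> has valuation
  \<open>n\<close> plus that of \<open>n!\<close>.\<close>

lemma multiplicity_fact_less:
  assumes p: "prime p" and "k > 0"
  shows "(p - 1) * multiplicity p (fact k :: nat) < k"
  using \<open>k > 0\<close>
proof (induction k rule: less_induct)
  case (less k)
  let ?v = "\<lambda>n. multiplicity p (fact n :: nat)"
  have p1: "p > 1" using p by (rule prime_gt_1_nat)
  have v_Suc: "?v (Suc n) = multiplicity p (Suc n) + ?v n" for n
    using p by (simp only: fact_Suc of_nat_id)
      (subst prime_elem_multiplicity_mult_distrib, auto)
  have step: "?v (p * n + r) = ?v (p * n)" if "r < p" for n r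
    using that
  proof (induction r)
    case (Suc r)
    have "\<not> p dvd Suc (p * n + r)"
      using Suc.prems by (metis add_Suc_right dvd_add_right_iff dvd_triv_left nat_dvd_not_less zero_less_Suc)
    then show ?case using Suc v_Suc by (simp add: not_dvd_imp_multiplicity_0)
  qed simp
  \<comment> \<open>Among \<open>p\<close> consecutive factors only the multiple
    \<open>p * Suc n\<close> contributes.\<close>
  have block: "?v (p * n) = n + ?v n" for n
  proof (induction n)
    case (Suc n)
    have eq: "p * Suc n = Suc (p * n + (p - 1))" using p1 by simp
    have "?v (p * Suc n) = multiplicity p (p * Suc n) + ?v (p * n + (p - 1))"
      unfolding eq by (rule v_Suc)
    also have "multiplicity p (p * Suc n) = Suc (multiplicity p (Suc n))"
      using p p1 by (intro multiplicity_times_same) auto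
    also have "?v (p * n + (p - 1)) = n + ?v n" using step[of "p - 1" n] p1 by (simp add: Suc.IH)
    finally show ?case by (simp add: v_Suc del: fact_Suc)
  qed simp
  define n r where "n = k div p" and "r = k mod p"
  have k: "k = p * n + r" "r < p" using p1 by (auto simp: n_def r_def)
  have v: "?v k = n + ?v n" using step[OF k(2), of n] block[of n] k(1) by simp
  show ?case
  proof (cases "n = 0")
    case True
    then show ?thesis using v less.prems by simp
  next
    case False
    then have "n < k" using p1 less.prems by (simp add: n_def)
    then have "(p - 1) * ?v n < n" using less.IH False by simp
    then have "(p - 1) * ?v k < (p - 1) * n + n" by (simp add: v distrib_left)
    also have "\<dots> = p * n" using p1 by (simp add: algebra_simps)
    finally show ?thesis using k by simp
  qed
qed

section \<open>Valuations of integers, inverses and powers over factorials\<close>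

lemma multiplicity_int_of_nat:
  assumes "prime p" "k \<noteq> 0"
  shows "multiplicity (int p) (int k) = multiplicity p k"
proof (rule multiplicity_eqI)
  show "int p ^ multiplicity p k dvd int k"
    by (metis multiplicity_dvd int_dvd_int_iff of_nat_power)
  have "\<not> p ^ Suc (multiplicity p k) dvd k"
    using assms by (subst power_dvd_iff_le_multiplicity) (auto simp: prime_gt_1_nat)
  then show "\<not> int p ^ Suc (multiplicity p k) dvd int k"
    by (metis int_dvd_int_iff of_nat_power)
qed

lemma padic_val_of_nat:
  "k \<noteq> 0 \<Longrightarrow> padic_val (of_nat k :: 'p::prime_card padic) = real (multiplicity CARD('p) k)"
  using padic_val_of_int[of "int k", where 'p = 'p]
  by (simp add: multiplicity_int_of_nat[OF prime_card])

lemma padic_val_of_nat_nonneg: "0 \<le> padic_val (of_nat k :: 'p::prime_card padic)"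
  by (cases "k = 0") (simp_all add: padic_val_of_nat)

lemma padic_val_of_int_nonneg: "0 \<le> padic_val (of_int k :: 'p::prime_card padic)"
  by (cases "k = 0") (simp_all add: padic_val_of_int)

lemma padic_val_inverse:
  fixes x :: "'p::prime_card padic"
  assumes "padic_val x = ereal r"
  shows "padic_val (inverse x) = ereal (- r)"
proof -
  have "x \<noteq> 0" using assms by auto
  then have "padic_val x + padic_val (inverse x) = 0" by (simp flip: padic_val_mult)
  then show ?thesis
    using assms by (cases "padic_val (inverse x)") (auto simp: zero_ereal_def)
qed

lemma padic_val_power_div_fact:
  "padic_val (of_nat CARD('p) ^ k / fact k :: 'p::prime_card padic) =
    ereal (real k - real (multiplicity CARD('p) (fact k :: nat)))"
proof -
  have p: "prime CARD('p)" by (rule prime_card)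
  then have "padic_val (of_nat CARD('p) :: 'p padic) = ereal 1"
    using prime_gt_0_nat[OF p] by (subst padic_val_of_nat) (auto simp: multiplicity_self)
  from padic_val_power[OF this, of k]
  have *: "padic_val (of_nat CARD('p) ^ k :: 'p padic) = ereal (real k)" by simp
  have "padic_val (of_nat (fact k) :: 'p padic) = ereal (real (multiplicity CARD('p) (fact k :: nat)))"
    by (rule padic_val_of_nat) simp
  from padic_val_inverse[OF this] show ?thesis
    by (simp add: divide_inverse padic_val_mult *)
qed

section \<open>Density of the rationals, completeness, and convergence of series\<close>

lemma padic_approx_rat:
  fixes x :: "'p::prime_card padic"
  shows "\<exists>r. ereal k \<le> padic_val (x - of_rat r)"
proof -
  obtain X where X: "padic_cauchy CARD('p) X" "x = Padic X" by (rule Padic_cases)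
  obtain N where N: "\<forall>m\<ge>N. \<forall>n\<ge>N. ereal k \<le> rat_val CARD('p) (X m - X n)"
    using padic_cauchyD[OF prime_card X(1)] ..
  have "x - of_rat (X N) = Padic (\<lambda>n. X n - X N)"
    by (simp add: X of_rat_padic Padic_diff prime_card)
  moreover have "padic_cauchy CARD('p) (\<lambda>n. X n - X N)"
    using padic_cauchy_add[OF prime_card X(1), of "\<lambda>n. - X N"] by (simp add: prime_card)
  ultimately have "(\<lambda>n. rat_val CARD('p) (X n - X N)) \<longlonglongrightarrow> padic_val (x - of_rat (X N))"
    using padic_val_tendsto by metis
  then have "ereal k \<le> padic_val (x - of_rat (X N))"
    by (rule LIMSEQ_le_const) (use N in blast)
  then show ?thesis ..
qed

text \<open>Approximate \<open>S n\<close> by a rational \<open>r n\<close> to precision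
  \<open>n\<close>. The sequence \<open>r\<close> is again Cauchy, and the number it represents is
  the limit.\<close>

lemma padic_complete:
  fixes S :: "nat \<Rightarrow> 'p::prime_card padic"
  assumes S: "\<And>k::real. \<exists>N. \<forall>m\<ge>N. \<forall>n\<ge>N. ereal k \<le> padic_val (S m - S n)"
  shows "\<exists>x. S \<longlonglongrightarrow> x"
proof -
  have "\<forall>n. \<exists>r. ereal (real n) \<le> padic_val (S n - of_rat r)" using padic_approx_rat by blast
  then obtain r where r: "\<And>n. ereal (real n) \<le> padic_val (S n - of_rat (r n))" by metis
  have near: "ereal k \<le> padic_val (S n - of_rat (r n))" if "n \<ge> nat \<lceil>k\<rceil>" for n k
  proof -
    have "ereal k \<le> ereal (real n)" using that by (simp add: nat_le_iff ceiling_le_iff)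
    then show ?thesis using r order_trans by blast
  qed
  have C: "padic_cauchy CARD('p) r"
    unfolding padic_cauchy_def
  proof
    fix k :: real
    obtain N where N: "\<forall>m\<ge>N. \<forall>n\<ge>N. ereal k \<le> padic_val (S m - S n)" using S by blast
    have "ereal k \<le> rat_val CARD('p) (r m - r n)"
      if "m \<ge> max N (nat \<lceil>k\<rceil>)" "n \<ge> max N (nat \<lceil>k\<rceil>)" for m n
    proof -
      have "ereal k \<le> padic_val ((S m - S n) - ((S m - of_rat (r m)) - (S n - of_rat (r n))))"
        using that N by (intro padic_val_diff_ge[OF _ padic_val_diff_ge[OF near near]]) auto
      also have "(S m - S n) - ((S m - of_rat (r m)) - (S n - of_rat (r n))) = of_rat (r m - r n)"
        by (simp add: of_rat_diff)
      finally show ?thesis by (simp add: padic_val_of_rat)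
    qed
    then show "\<exists>N. \<forall>m\<ge>N. \<forall>n\<ge>N. ereal k \<le> rat_val CARD('p) (r m - r n)" by blast
  qed
  have "S \<longlonglongrightarrow> Padic r"
    unfolding padic_tendsto_iff tendsto_PInfty
  proof
    fix k :: real
    obtain N where N: "\<forall>m\<ge>N. \<forall>n\<ge>N. ereal (k + 1) \<le> rat_val CARD('p) (r m - r n)"
      using padic_cauchyD[OF prime_card C] ..
    have "ereal k < padic_val (S n - Padic r)" if n: "n \<ge> max N (nat \<lceil>k + 1\<rceil>)" for n
    proof -
      have "of_rat (r n) - Padic r = (Padic (\<lambda>m. r n - r m) :: 'p padic)"
        by (simp add: C of_rat_padic Padic_diff prime_card)
      moreover have "padic_cauchy CARD('p) (\<lambda>m. r n - r m)"
        using padic_cauchy_add[OF prime_card[where 'a = 'p], of "\<lambda>m. r n" "\<lambda>m. - r m"] C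
        by (simp add: prime_card)
      ultimately have "(\<lambda>m. rat_val CARD('p) (r n - r m)) \<longlonglongrightarrow>
          padic_val (of_rat (r n) - Padic r :: 'p padic)"
        using padic_val_tendsto by metis
      then have "ereal (k + 1) \<le> padic_val (of_rat (r n) - Padic r :: 'p padic)"
        by (rule LIMSEQ_le_const) (use N n in auto)
      then have "ereal (k + 1) \<le> padic_val ((S n - of_rat (r n)) + (of_rat (r n) - Padic r))"
        using n by (intro padic_val_add_ge near) auto
      then have "ereal (k + 1) \<le> padic_val (S n - Padic r)" by simp
      moreover have "ereal k < ereal (k + 1)" by simp
      ultimately show ?thesis by (rule less_le_trans[rotated])
    qed
    then show "\<forall>\<^sub>F n in sequentially. ereal k < padic_val (S n - Padic r)"
      unfolding eventually_sequentially by blast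
  qed
  then show ?thesis ..
qed

text \<open>Lower bounds on valuations survive limits: once \<open>S n\<close> is closer to
  \<open>x\<close> than \<open>y\<close> is, the ultrametric inequality bounds the valuation of
  \<open>S n - y\<close> by that of \<open>x - y\<close>.\<close>

lemma padic_tendsto_val_diff_ge:
  fixes S :: "nat \<Rightarrow> 'p::prime_card padic"
  assumes "S \<longlonglongrightarrow> x" "\<And>n. n \<ge> N \<Longrightarrow> c \<le> padic_val (S n - y)"
  shows "c \<le> padic_val (x - y)"
proof (cases "padic_val (x - y)")
  case (real r)
  then have "\<forall>\<^sub>F n in sequentially. ereal r < padic_val (S n - x)"
    using assms(1) by (simp add: padic_tendsto_iff tendsto_PInfty)
  then obtain N' where N': "\<And>n. n \<ge> N' \<Longrightarrow> ereal r < padic_val (S n - x)"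
    by (auto simp: eventually_sequentially)
  define n where "n = max N N'"
  have n: "c \<le> padic_val (S n - y)" "ereal r < padic_val (S n - x)"
    using assms(2) N' by (auto simp: n_def)
  have "min (padic_val (S n - y)) (padic_val (S n - x)) \<le> padic_val ((S n - y) - (S n - x))"
    by (rule padic_val_diff_ge) auto
  then have "min (padic_val (S n - y)) (padic_val (S n - x)) \<le> ereal r" using real by simp
  then have "padic_val (S n - y) \<le> ereal r" using n(2) by (auto simp: min_def split: if_splits)
  then show ?thesis using n(1) real by simp
next
  case MInf
  then show ?thesis by (metis MInfty_neq_ereal(1) MInfty_neq_PInfty(1) padic_val_eq_infty_iff padic_val_finite)
qed simp

text \<open>By the ultrametric inequality, terms tending to zero already make the partial sums
  Cauchy.\<close>

lemma padic_summable:
  fixes t :: "nat \<Rightarrow> 'p::prime_card padic"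
  assumes "(\<lambda>k. padic_val (t k)) \<longlonglongrightarrow> \<infinity>"
  shows "\<exists>x. t sums x"
proof -
  have "\<exists>x. (\<lambda>n. \<Sum>k<n. t k) \<longlonglongrightarrow> x"
  proof (rule padic_complete)
    fix k :: real
    obtain N where N: "\<And>j. j \<ge> N \<Longrightarrow> ereal k < padic_val (t j)"
      using assms by (auto simp: tendsto_PInfty eventually_sequentially)
    have le: "ereal k \<le> padic_val (sum t {..<n} - sum t {..<m})" if "m \<ge> N" "m \<le> n" for m n
    proof -
      have "sum t {..<n} - sum t {..<m} = sum t {m..<n}"
        using sum_diff_nat_ivl[of 0 m n t] that by (simp add: atLeast0LessThan)
      moreover have "ereal k \<le> padic_val (sum t {m..<n})"
        using that by (intro padic_val_sum_ge less_imp_le[OF N]) auto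
      ultimately show ?thesis by simp
    qed
    have "ereal k \<le> padic_val (sum t {..<m} - sum t {..<n})" if "m \<ge> N" "n \<ge> N" for m n
      using le[of m n] le[of n m] that padic_val_minus[of "sum t {..<m} - sum t {..<n}"]
      by (cases "m \<le> n") auto
    then show "\<exists>N. \<forall>m\<ge>N. \<forall>n\<ge>N. ereal k \<le> padic_val (sum t {..<m} - sum t {..<n})" by blast
  qed
  then show ?thesis by (simp add: sums_def)
qed

section \<open>Further ultrametric estimates\<close>

lemma padic_val_sum_gt:
  "finite A \<Longrightarrow> (\<And>i. i \<in> A \<Longrightarrow> ereal m < padic_val (f i)) \<Longrightarrow> ereal m < padic_val (sum f A)"
  by (induction A rule: finite_induct) (auto intro: less_le_trans[OF _ padic_val_add])

lemma padic_val_ge_mult_integral: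
  assumes "c \<le> padic_val x" "0 \<le> padic_val y"
  shows "c \<le> padic_val (x * y)"
  using add_mono[OF assms] by (simp add: padic_val_mult)

lemma padic_val_power_nonneg: "0 \<le> padic_val x \<Longrightarrow> 0 \<le> padic_val (x ^ n)"
  by (induction n) (simp_all add: padic_val_mult)

lemma padic_eqI:
  fixes x y :: "'p::prime_card padic"
  assumes "\<And>r::real. ereal r \<le> padic_val (x - y)"
  shows "x = y"
proof -
  have "padic_val (x - y) = \<infinity>" using assms by (intro ereal_top) 
  then show ?thesis by simp
qed

lemma tendsto_PInfty_mono:
  fixes f g :: "nat \<Rightarrow> ereal"
  assumes "f \<longlonglongrightarrow> \<infinity>" "\<And>n. f n \<le> g n"
  shows "g \<longlonglongrightarrow> \<infinity>"
  unfolding tendsto_PInfty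
proof
  fix r :: real
  have "\<forall>\<^sub>F n in sequentially. ereal r < f n" using assms(1) by (simp add: tendsto_PInfty)
  then show "\<forall>\<^sub>F n in sequentially. ereal r < g n"
    by (rule eventually_mono) (rule less_le_trans[OF _ assms(2)])
qed

section \<open>Series of falling factorials\<close>

definition falling_poly :: "nat \<Rightarrow> 'a::comm_ring_1 poly" where
  "falling_poly k = (\<Prod>i<k. [:- of_nat i, 1:])"

lemma falling_poly_Suc:
  "falling_poly (Suc k) = smult (- of_nat k) (falling_poly k) + pCons 0 (falling_poly k)"
  by (simp add: falling_poly_def)

lemma lead_coeff_falling_poly: "lead_coeff (falling_poly k :: 'a::idom poly) = 1"
  by (simp add: falling_poly_def lead_coeff_prod)

lemma degree_falling_poly: "degree (falling_poly k :: 'a::idom poly) = k"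
  by (simp add: falling_poly_def degree_prod_eq_sum_degree)

lemma poly_falling_poly_of_nat:
  "poly (falling_poly k) (of_nat n :: 'a::field_char_0) = fact k * of_nat (n choose k)"
  by (simp add: falling_poly_def poly_prod binomial_gbinomial gbinomial_mult_fact atLeast0LessThan)

lemma padic_val_coeff_falling_poly:
  "0 \<le> padic_val (coeff (falling_poly k) j :: 'p::prime_card padic)"
proof (induction k arbitrary: j)
  case 0
  then show ?case by (simp add: falling_poly_def coeff_1)
next
  case (Suc k)
  have "0 \<le> padic_val (of_nat k * coeff (falling_poly k) j :: 'p padic)"
    by (intro padic_val_ge_mult_integral padic_val_of_nat_nonneg Suc.IH)
  then show ?case using Suc.IH
    by (auto simp: falling_poly_Suc coeff_pCons intro!: padic_val_add_ge padic_val_diff_ge split: nat.split)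
qed

lemma has_power_series_imp_padic_analytic:
  fixes F :: "'p::prime_card padic \<Rightarrow> 'p padic"
  assumes "has_power_series F b"
  shows "padic_analytic F"
proof -
  have "F x \<in> padic_ints" if x: "x \<in> padic_ints" for x
  proof -
    have "(\<lambda>n. \<Sum>j<n. b j * x ^ j) \<longlonglongrightarrow> F x"
      using assms x by (auto simp: has_power_series_def sums_def)
    moreover have "0 \<le> padic_val ((\<Sum>j<n. b j * x ^ j) - 0)" for n
      using assms x unfolding diff_0_right
      by (intro padic_val_sum_ge padic_val_ge_mult_integral padic_val_power_nonneg)
        (auto simp: has_power_series_def padic_ints_def)
    ultimately have "0 \<le> padic_val (F x - 0)" by (rule padic_tendsto_val_diff_ge)
    then show ?thesis by (simp add: padic_ints_def)
  qed
  then show ?thesis using assms by (auto simp: padic_analytic_def)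
qed

text \<open>Rearranging by powers of x gives \<open>b j\<close> as the sum of \<open>c k\<close>
  times signed Stirling numbers of the first kind, which are integral. The last conclusion bounds
  the error of truncating this sum uniformly in \<open>j\<close>; \<open>e\<close> may be
  infinite.\<close>

lemma falling_series_has_power_series:
  fixes c :: "nat \<Rightarrow> 'p::prime_card padic"
  assumes int: "\<And>k. 0 \<le> padic_val (c k)" and lim: "(\<lambda>k. padic_val (c k)) \<longlonglongrightarrow> \<infinity>"
  obtains F b where "has_power_series F b"
    "\<And>n. F (of_nat n) = (\<Sum>k\<le>n. c k * (fact k * of_nat (n choose k)))"
    "\<And>e N j. (\<And>k. k \<ge> N \<Longrightarrow> e \<le> padic_val (c k)) \<Longrightarrow>
      e \<le> padic_val (b j - (\<Sum>k<N. c k * coeff (falling_poly k) j))"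
proof -
  let ?s = "\<lambda>k j. coeff (falling_poly k) j :: 'p padic"
  have coeff_mult_ge: "e \<le> padic_val (c k) \<Longrightarrow> e \<le> padic_val (c k * ?s k j)" for e k j
    by (rule padic_val_ge_mult_integral[OF _ padic_val_coeff_falling_poly])
  have "\<exists>x. (\<lambda>k. c k * ?s k j) sums x" for j
    by (intro padic_summable tendsto_PInfty_mono[OF lim] coeff_mult_ge order_refl)
  then obtain b where b: "\<And>j. (\<lambda>k. c k * ?s k j) sums b j" by metis
  have approx: "e \<le> padic_val (b j - (\<Sum>k<N. c k * ?s k j))"
    if "\<And>k. k \<ge> N \<Longrightarrow> e \<le> padic_val (c k)" for e N j
  proof (rule padic_tendsto_val_diff_ge)
    show "(\<lambda>n. \<Sum>k<n. c k * ?s k j) \<longlonglongrightarrow> b j" using b by (simp add: sums_def)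
    fix n assume "n \<ge> N"
    then have "(\<Sum>k<n. c k * ?s k j) - (\<Sum>k<N. c k * ?s k j) = (\<Sum>k=N..<n. c k * ?s k j)"
      using sum_diff_nat_ivl[of 0 N n "\<lambda>k. c k * ?s k j"] by (simp add: atLeast0LessThan)
    then show "e \<le> padic_val ((\<Sum>k<n. c k * ?s k j) - (\<Sum>k<N. c k * ?s k j))"
      using that by (auto intro!: padic_val_sum_ge coeff_mult_ge)
  qed
  have b_int: "0 \<le> padic_val (b j)" for j using approx[of 0 0 j] int by simp
  \<comment> \<open>\<open>falling_poly k\<close> with \<open>k < j\<close> has no term in
    \<open>x^j\<close>, so truncating at \<open>j\<close> subtracts nothing.\<close>
  have b_ge: "e \<le> padic_val (b j)" if "\<And>k. k \<ge> j \<Longrightarrow> e \<le> padic_val (c k)" for e j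
    using approx[of j e j] that by (simp add: coeff_eq_0 degree_falling_poly)
  have b_lim: "(\<lambda>j. padic_val (b j)) \<longlonglongrightarrow> \<infinity>"
    unfolding tendsto_PInfty
  proof
    fix r :: real
    obtain N where N: "\<And>k. k \<ge> N \<Longrightarrow> ereal (r + 1) < padic_val (c k)"
      using lim unfolding tendsto_PInfty eventually_sequentially by meson
    have "ereal r < padic_val (b j)" if "j \<ge> N" for j
    proof -
      have "ereal (r + 1) \<le> padic_val (b j)" using that N by (intro b_ge less_imp_le) simp
      moreover have "ereal r < ereal (r + 1)" by simp
      ultimately show ?thesis by (rule less_le_trans[rotated])
    qed
    then show "\<forall>\<^sub>F j in sequentially. ereal r < padic_val (b j)"
      unfolding eventually_sequentially by blast
  qed
  define F where "F x = (\<Sum>j. b j * x ^ j)" for x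
  have F: "(\<lambda>j. b j * x ^ j) sums F x" if x: "x \<in> padic_ints" for x
  proof -
    have "(\<lambda>j. padic_val (b j * x ^ j)) \<longlonglongrightarrow> \<infinity>"
      using x by (intro tendsto_PInfty_mono[OF b_lim] padic_val_ge_mult_integral padic_val_power_nonneg)
        (auto simp: padic_ints_def)
    from padic_summable[OF this] have "summable (\<lambda>j. b j * x ^ j)" unfolding summable_def .
    then show ?thesis unfolding F_def by (rule summable_sums)
  qed
  show ?thesis
  proof
    show "has_power_series F b"
      using F b_int b_lim by (auto simp: has_power_series_def padic_ints_def)
    show "F (of_nat n) = (\<Sum>k\<le>n. c k * (fact k * of_nat (n choose k)))" for n
    proof (rule padic_eqI)
      fix r :: real
      let ?x = "of_nat n :: 'p padic"
      obtain N where N: "\<And>k. k \<ge> N \<Longrightarrow> ereal r < padic_val (c k)"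
        using lim unfolding tendsto_PInfty eventually_sequentially by meson
      \<comment> \<open>Both series are truncated, which avoids interchanging infinite sums.
        \<open>K > n\<close> makes all omitted binomials vanish, and \<open>m \<ge> K\<close> lets
        every \<open>falling_poly k\<close> with \<open>k < K\<close> be summed completely.\<close>
      define K where "K = max N (Suc n)"
      have x: "?x \<in> padic_ints" by (simp add: padic_ints_def padic_val_of_nat_nonneg)
      have "ereal r \<le> padic_val (F ?x - (\<Sum>k\<le>n. c k * (fact k * of_nat (n choose k))))"
      proof (rule padic_tendsto_val_diff_ge)
        show "(\<lambda>m. \<Sum>j<m. b j * ?x ^ j) \<longlonglongrightarrow> F ?x" using F[OF x] by (simp add: sums_def)
        fix m assume m: "m \<ge> K"
        have "(\<Sum>k\<le>n. c k * (fact k * of_nat (n choose k))) =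
            (\<Sum>k<K. c k * (fact k * of_nat (n choose k)))"
          by (rule sum.mono_neutral_left) (auto simp: K_def not_le)
        also have "\<dots> = (\<Sum>k<K. c k * (\<Sum>j<m. ?s k j * ?x ^ j))"
        proof (rule sum.cong)
          fix k assume "k \<in> {..<K}"
          then have "(\<Sum>j<m. ?s k j * ?x ^ j) = poly (falling_poly k) ?x"
            using m unfolding poly_altdef
            by (intro sum.mono_neutral_right) (auto simp: degree_falling_poly coeff_eq_0)
          then show "c k * (fact k * of_nat (n choose k)) = c k * (\<Sum>j<m. ?s k j * ?x ^ j)"
            by (simp add: poly_falling_poly_of_nat)
        qed simp
        also have "\<dots> = (\<Sum>j<m. (\<Sum>k<K. c k * ?s k j) * ?x ^ j)"
          unfolding sum_distrib_left sum_distrib_right by (subst sum.swap) (simp add: mult.assoc)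
        finally have "(\<Sum>j<m. b j * ?x ^ j) - (\<Sum>k\<le>n. c k * (fact k * of_nat (n choose k))) =
            (\<Sum>j<m. (b j - (\<Sum>k<K. c k * ?s k j)) * ?x ^ j)"
          by (simp add: left_diff_distrib sum_subtractf)
        also have "ereal r \<le> padic_val \<dots>"
        proof (intro padic_val_sum_ge padic_val_ge_mult_integral padic_val_power_nonneg
            padic_val_of_nat_nonneg approx finite_lessThan)
          show "ereal r \<le> padic_val (c k)" if "k \<ge> K" for k
            using N[of k] that by (simp add: K_def)
        qed
        finally show "ereal r \<le> padic_val ((\<Sum>j<m. b j * ?x ^ j) -
            (\<Sum>k\<le>n. c k * (fact k * of_nat (n choose k))))" .
      qed
      then show "ereal r \<le> padic_val (F ?x - (\<Sum>k\<le>n. c k * (fact k * of_nat (n choose k))))" .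
    qed
  qed (rule approx)
qed

text \<open>By Pascal's rule, differencing shifts the Newton coefficients by one. At
  \<open>n = 0\<close> only \<open>D j\<close> survives.\<close>

lemma funpow_fwd_diff_of_nat:
  fixes F :: "'a::ring_1 \<Rightarrow> 'a"
  assumes "\<And>n. F (of_nat n) = (\<Sum>k\<le>n. of_nat (n choose k) * D k)"
  shows "(fwd_diff ^^ j) F (of_nat n) = (\<Sum>k\<le>n. of_nat (n choose k) * D (k + j))"
proof (induction j arbitrary: n)
  case (Suc j)
  let ?X = "\<lambda>k. D (k + j)"
  have "(\<Sum>k\<le>n. of_nat (n choose k) * ?X k) = (\<Sum>k\<le>Suc n. of_nat (n choose k) * ?X k)"
    by (simp add: binomial_eq_0)
  also have "\<dots> = ?X 0 + (\<Sum>k\<le>n. of_nat (n choose Suc k) * ?X (Suc k))"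
    by (subst sum.atMost_Suc_shift) simp
  finally have 1: "(\<Sum>k\<le>n. of_nat (n choose k) * ?X k) = \<dots>" .
  have 2: "(\<Sum>k\<le>Suc n. of_nat (Suc n choose k) * ?X k) =
      ?X 0 + (\<Sum>k\<le>n. (of_nat (n choose k) + of_nat (n choose Suc k)) * ?X (Suc k))"
    by (subst sum.atMost_Suc_shift) simp
  have "(fwd_diff ^^ Suc j) F (of_nat n) =
      (fwd_diff ^^ j) F (of_nat (Suc n)) - (fwd_diff ^^ j) F (of_nat n)"
    by (simp add: fwd_diff_def add.commute)
  also have "\<dots> = (\<Sum>k\<le>Suc n. of_nat (Suc n choose k) * ?X k) - (\<Sum>k\<le>n. of_nat (n choose k) * ?X k)"
    by (simp only: Suc.IH)
  also have "\<dots> = (\<Sum>k\<le>n. of_nat (n choose k) * D (k + Suc j))"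
    unfolding 1 2 by (simp add: distrib_right sum.distrib)
  finally show ?case .
qed (simp add: assms)

section \<open>The minimal valuation of the coefficients\<close>

text \<open>In Legendre's bound \<open>p - 1\<close> may be lowered to 2 or to \<open>d + 1\<close>.
  The first bound serves convergence, the second makes \<open>k!\<close> a unit, and the third lifts
  the terms from index \<open>d\<close> on above the minimum.\<close>

lemma multiplicity_fact_bounds:
  assumes p: "prime p" and d: "d > 0" "d + 1 < p"
  shows "2 * multiplicity p (fact k :: nat) \<le> k"
    and "k < p \<Longrightarrow> multiplicity p (fact k :: nat) = 0"
    and "d \<le> k \<Longrightarrow> multiplicity p (fact k :: nat) + d \<le> k"
proof -
  let ?v = "multiplicity p (fact k :: nat)"
  have *: "n * ?v < k" if "?v > 0" "n < p" for n
  proof -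
    have "k > 0" using that(1) by (cases "k = 0") auto
    from multiplicity_fact_less[OF p this] have "(p - 1) * ?v < k" .
    moreover have "n * ?v \<le> (p - 1) * ?v" using that by (intro mult_right_mono) auto
    ultimately show ?thesis by (rule le_less_trans[rotated])
  qed
  show "2 * ?v \<le> k" using *[of 2] d by (cases "?v = 0") auto
  show "?v = 0" if "k < p"
  proof (rule ccontr)
    assume v: "?v \<noteq> 0"
    then have "p - 1 \<le> (p - 1) * ?v" by simp
    also have "\<dots> < k" using v p by (intro *) (auto dest: prime_gt_0_nat)
    finally show False using that by simp
  qed
  show "?v + d \<le> k" if "d \<le> k"
  proof (cases "?v = 0")
    case False
    then have "?v + d \<le> (d + 1) * ?v" by simp
    also have "\<dots> < k" using False d by (intro *) auto
    finally show ?thesis by simp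
  qed (use that in simp)
qed

text \<open>Integral combinations cannot lower the valuation. With infinite \<open>c\<close>,
  vanishing of the first \<open>d\<close> terms propagates to all.\<close>

lemma recurrence_val_ge:
  fixes w e :: "nat \<Rightarrow> int"
  assumes rec: "\<And>k. w (k + d) = (\<Sum>i<d. e i * w (k + i))"
    and init: "\<And>k. k < d \<Longrightarrow> c \<le> padic_val (of_int (w k) :: 'p::prime_card padic)"
  shows "c \<le> padic_val (of_int (w k) :: 'p padic)"
proof (induction k rule: less_induct)
  case (less k)
  show ?case
  proof (cases "k < d")
    case False
    define k' where "k' = k - d"
    have k: "k = k' + d" using False by (simp add: k'_def)
    have "(of_int (w k) :: 'p padic) = (\<Sum>i<d. of_int (w (k' + i)) * of_int (e i))"
      by (simp add: k rec mult.commute)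
    also have "c \<le> padic_val \<dots>"
      by (intro padic_val_sum_ge padic_val_ge_mult_integral padic_val_of_int_nonneg less)
        (auto simp: k)
    finally show ?thesis .
  qed (rule init)
qed

lemma min_coeff_val_last_min_index_eq:
  fixes F :: "'p::prime_card padic \<Rightarrow> 'p padic"
  assumes b: "has_power_series F b"
    and ge: "\<And>j. m \<le> padic_val (b j)" and J: "padic_val (b J) = m"
    and gt: "\<And>j. J < j \<Longrightarrow> m < padic_val (b j)"
  shows "min_coeff_val F = m" "last_min_index F = J"
proof -
  show m: "min_coeff_val F = m"
    unfolding min_coeff_val_def power_series_coeff_eq[OF b]
    using ge J by (intro antisym INF_greatest) (auto intro: INF_lower2[of J])
  show "last_min_index F = J"
    unfolding last_min_index_def m power_series_coeff_eq[OF b]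
    by (rule Greatest_equality) (use J gt in \<open>auto simp: not_le[symmetric] less_le\<close>)
qed

lemma interpolation_analytic:
  fixes w e :: "nat \<Rightarrow> int"
  assumes d: "d > 0" "d + 1 < CARD('p::prime_card)"
    and rec: "\<And>k. w (k + d) = (\<Sum>i<d. e i * w (k + i))"
  obtains F :: "'p::prime_card padic \<Rightarrow> 'p padic" where "padic_analytic F"
    "\<And>n. F (of_nat n) = of_int (\<Sum>k\<le>n. int (n choose k) * (int CARD('p) ^ k * w k))"
    "(\<exists>x\<in>padic_ints. F x \<noteq> 0) \<Longrightarrow>
      min_coeff_val F = Min {padic_val ((fwd_diff ^^ j) F 0) |j. j \<le> d - 1} \<and>
      last_min_index F =
        Max {j. j \<le> d - 1 \<and> padic_val ((fwd_diff ^^ j) F 0) = min_coeff_val F}"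
proof -
  let ?p = "CARD('p)"
  let ?v = "\<lambda>k. multiplicity ?p (fact k :: nat)"
  note fact_bounds = multiplicity_fact_bounds[OF prime_card d]
  define W where "W k = (of_int (w k) :: 'p padic)" for k
  \<comment> \<open>Dividing by \<open>k!\<close> turns a binomial coefficient into a falling
    factorial.\<close>
  define c where "c k = of_nat ?p ^ k / fact k * W k" for k
  have val_c: "padic_val (c k) = ereal (real k - real (?v k)) + padic_val (W k)" for k
    by (simp only: c_def padic_val_mult padic_val_power_div_fact)
  have c_ge: "ereal (real k / 2) \<le> padic_val (c k)" for k
  proof -
    have "real k / 2 \<le> real k - real (?v k)" using fact_bounds(1)[of k] by linarith
    then have "ereal (real k / 2) + 0 \<le> ereal (real k - real (?v k)) + padic_val (W k)"
      unfolding W_def by (intro add_mono padic_val_of_int_nonneg) simp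
    then show ?thesis by (simp add: val_c)
  qed
  have c_int: "0 \<le> padic_val (c k)" for k
    using c_ge[of k] order_trans[of 0 "ereal (real k / 2)"] by simp
  have "(\<lambda>k. ereal (real k / 2)) \<longlonglongrightarrow> \<infinity>"
    unfolding tendsto_PInfty_eq_at_top by real_asymp
  then have c_lim: "(\<lambda>k. padic_val (c k)) \<longlonglongrightarrow> \<infinity>" by (rule tendsto_PInfty_mono) (rule c_ge)
  obtain F b where F: "has_power_series F b"
    "\<And>n. F (of_nat n) = (\<Sum>k\<le>n. c k * (fact k * of_nat (n choose k)))"
    "\<And>e N j. (\<And>k. k \<ge> N \<Longrightarrow> e \<le> padic_val (c k)) \<Longrightarrow>
      e \<le> padic_val (b j - (\<Sum>k<N. c k * coeff (falling_poly k) j))"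
    by (rule falling_series_has_power_series[OF c_int c_lim]) blast
  define D where "D k = of_nat ?p ^ k * W k" for k
  have newton: "F (of_nat n) = (\<Sum>k\<le>n. of_nat (n choose k) * D k)" for n
    unfolding F(2) by (intro sum.cong) (simp_all add: c_def D_def)
  have "(fwd_diff ^^ j) F (of_nat 0) = D j" for j
    by (subst funpow_fwd_diff_of_nat[OF newton]) simp
  then have diff: "(fwd_diff ^^ j) F 0 = D j" for j by simp
  \<comment> \<open>Here \<open>k < d < p\<close>, so \<open>k!\<close> is a unit and the two
    scalings agree in valuation.\<close>
  have val_c_less: "padic_val (c k) = padic_val (D k)" and
    val_W: "padic_val (c k) = ereal (real k) + padic_val (W k)" if "k < d" for k
  proof -
    have v: "?v k = 0" using that d by (intro fact_bounds(2)) simp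
    show "padic_val (c k) = ereal (real k) + padic_val (W k)" by (simp add: val_c v)
    have "D k = c k * of_nat (fact k)" by (simp add: c_def D_def)
    also have "padic_val \<dots> = padic_val (c k)"
      by (subst padic_val_mult, subst padic_val_of_nat) (simp_all add: v flip: zero_ereal_def)
    finally show "padic_val (c k) = padic_val (D k)" by simp
  qed
  show ?thesis
  proof
    show "padic_analytic F" by (rule has_power_series_imp_padic_analytic[OF F(1)])
    show "F (of_nat n) = of_int (\<Sum>k\<le>n. int (n choose k) * (int ?p ^ k * w k))" for n
      by (simp add: newton D_def W_def)
    assume nz: "\<exists>x\<in>padic_ints. F x \<noteq> 0"
    define V where "V = (\<lambda>j. padic_val (c j)) ` {..<d}"
    have V: "finite V" "V \<noteq> {}" using d by (auto simp: V_def)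
    have le_d: "j \<le> d - 1 \<longleftrightarrow> j < d" for j using d(1) by linarith
    have V_eq: "{padic_val ((fwd_diff ^^ j) F 0) |j. j \<le> d - 1} = V"
      unfolding V_def diff le_d using val_c_less by (auto intro!: image_eqI)
    have Min_le_c: "Min V \<le> padic_val (c k)" if "k < d" for k
      using V that by (intro Min_le) (auto simp: V_def)
    \<comment> \<open>Otherwise the first \<open>d\<close> values of \<open>W\<close> vanish, the
      recurrence kills the rest, and \<open>F\<close> is zero.\<close>
    have "Min V \<noteq> \<infinity>"
    proof
      assume inf: "Min V = \<infinity>"
      have "\<infinity> \<le> padic_val (W k)" if "k < d" for k
        using Min_le_c[OF that] val_W[OF that] inf by (cases "padic_val (W k)") auto
      then have "\<infinity> \<le> padic_val (W k)" for k
        unfolding W_def by (rule recurrence_val_ge[OF rec])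
      then have "\<infinity> \<le> padic_val (c k)" for k by (simp add: val_c)
      then have "b j = 0" for j using F(3)[of 0 \<infinity> j] by simp
      then have "(\<lambda>j. 0) sums F x" if "x \<in> padic_ints" for x
        using F(1) that by (simp add: has_power_series_def)
      then show False using nz sums_0 sums_unique2 by metis
    qed
    moreover have "Min V \<noteq> - \<infinity>"
      using V c_int by (metis (no_types, lifting) Min_in V_def imageE ereal_infty_less_eq(2) MInfty_neq_ereal(1) zero_ereal_def)
    ultimately obtain m where m: "Min V = ereal m" by (cases "Min V") auto
    \<comment> \<open>For \<open>k < d\<close> the power of \<open>p\<close> accounts for at most
      \<open>d - 1\<close> of the valuation of \<open>c k\<close>.\<close>
    have "ereal (m - (real d - 1)) \<le> padic_val (W k)" if "k < d" for k
      using Min_le_c[OF that] val_W[OF that] m that by (cases "padic_val (W k)") auto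
    then have W_ge: "ereal (m - (real d - 1)) \<le> padic_val (W k)" for k
      unfolding W_def by (rule recurrence_val_ge[OF rec])
    \<comment> \<open>From index \<open>d\<close> on, \<open>p^k / k!\<close> contributes at least
      \<open>d\<close>, one more than the possible loss \<open>d - 1\<close> in
      \<open>W\<close>.\<close>
    have c_tail: "ereal (m + 1) \<le> padic_val (c k)" if "k \<ge> d" for k
    proof -
      have "real d \<le> real k - real (?v k)" using fact_bounds(3)[OF that] by linarith
      then have "ereal (real d) + ereal (m - (real d - 1)) \<le> padic_val (c k)"
        unfolding val_c by (intro add_mono W_ge) simp
      then show ?thesis by simp
    qed
    define T where "T j = (\<Sum>k<d. c k * coeff (falling_poly k) j)" for j
    have tail: "ereal m < padic_val (b j - T j)" for j
    proof -
      have "ereal (m + 1) \<le> padic_val (b j - T j)" unfolding T_def by (rule F(3)[OF c_tail])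
      moreover have "ereal m < ereal (m + 1)" by simp
      ultimately show ?thesis by (rule less_le_trans[rotated])
    qed
    define S where "S = {j. j < d \<and> padic_val (c j) = ereal m}"
    have "ereal m \<in> V" using Min_in[OF V] by (simp only: m)
    then have S: "finite S" "S \<noteq> {}" by (auto simp: S_def V_def)
    define J where "J = Max S"
    have "J \<in> S" unfolding J_def using S by (rule Max_in)
    then have J: "J < d" "padic_val (c J) = ereal m" by (auto simp: S_def)
    have J_max: "ereal m < padic_val (c k)" if "J < k" "k < d" for k
    proof -
      have "k \<notin> S" using S(1) that unfolding J_def by (meson Max_ge not_le)
      then show ?thesis using Min_le_c[OF that(2)] that by (auto simp: S_def m less_le)
    qed
    \<comment> \<open>In \<open>T j\<close> with \<open>J \<le> j\<close>, terms with
      \<open>k < J\<close> vanish by degree, \<open>k = J\<close> gives \<open>c J\<close> exactly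
      when \<open>j = J\<close> because \<open>falling_poly J\<close> is monic, and terms with
      \<open>k > J\<close> have valuation above \<open>m\<close>.\<close>
    have head: "ereal m < padic_val (T j - (if j = J then c J else 0))" if "J \<le> j" for j
    proof -
      have "T j - (if j = J then c J else 0) =
          (\<Sum>k<d. if k \<le> J then 0 else c k * coeff (falling_poly k) j)"
      proof -
        have "(if j = J then c J else 0) = (\<Sum>k<d. if k = J then (if j = J then c J else 0) else 0)"
          using J by simp
        then have "T j - (if j = J then c J else 0) = (\<Sum>k<d. c k * coeff (falling_poly k) j -
            (if k = J then (if j = J then c J else 0) else 0))"
          unfolding T_def sum_subtractf by simp
        also have "\<dots> = (\<Sum>k<d. if k \<le> J then 0 else c k * coeff (falling_poly k) j)"
          using that lead_coeff_falling_poly[of J, where 'a = "'p padic"]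
          by (intro sum.cong) (auto simp: coeff_eq_0 degree_falling_poly)
        finally show ?thesis .
      qed
      also have "ereal m < padic_val \<dots>"
      proof (rule padic_val_sum_gt)
        fix k assume "k \<in> {..<d}"
        then show "ereal m < padic_val (if k \<le> J then 0 else c k * coeff (falling_poly k) j)"
          using less_le_trans[OF J_max padic_val_ge_mult_integral[OF order_refl
              padic_val_coeff_falling_poly[of k j]]] by simp
      qed simp
      finally show ?thesis .
    qed
    have b_near: "ereal m < padic_val (b j - (if j = J then c J else 0))" if "J \<le> j" for j
    proof -
      have "ereal m < padic_val ((b j - T j) + (T j - (if j = J then c J else 0)))"
        using tail[of j] head[OF that] by (intro less_le_trans[OF _ padic_val_add]) simp
      then show ?thesis by simp
    qed
    have b_ge: "ereal m \<le> padic_val (b j)" for j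
    proof -
      have T: "ereal m \<le> padic_val (T j)"
        unfolding T_def using Min_le_c m
        by (intro padic_val_sum_ge padic_val_ge_mult_integral padic_val_coeff_falling_poly) auto
      have "ereal m \<le> padic_val ((b j - T j) + T j)"
        by (rule padic_val_add_ge[OF less_imp_le[OF tail] T])
      then show ?thesis by simp
    qed
    \<comment> \<open>Were the valuation larger, \<open>c J = b J - (b J - c J)\<close> would also
      exceed \<open>m\<close>.\<close>
    have "padic_val (b J) = ereal m"
    proof (rule antisym[OF _ b_ge], rule ccontr)
      assume "\<not> padic_val (b J) \<le> ereal m"
      then have "ereal m < padic_val (b J + - (b J - c J))"
        using b_near[of J] padic_val_minus[of "b J - c J"]
        by (intro less_le_trans[OF _ padic_val_add]) (simp add: not_le)
      then show False by (simp add: J)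
    qed
    moreover have "ereal m < padic_val (b j)" if "J < j" for j
      using b_near[of j] that by simp
    ultimately have "min_coeff_val F = ereal m" "last_min_index F = J"
      using min_coeff_val_last_min_index_eq[OF F(1) b_ge] by blast+
    moreover have "{j. j \<le> d - 1 \<and> padic_val ((fwd_diff ^^ j) F 0) = ereal m} = S"
      unfolding S_def diff le_d using val_c_less by auto
    ultimately show "min_coeff_val F = Min {padic_val ((fwd_diff ^^ j) F 0) |j. j \<le> d - 1} \<and>
      last_min_index F =
        Max {j. j \<le> d - 1 \<and> padic_val ((fwd_diff ^^ j) F 0) = min_coeff_val F}"
      unfolding V_eq by (simp add: m J_def)
  qed
qed

section \<open>Assembly over the residue classes modulo \<open>M\<close>\<close>

theorem theorem5:
  fixes u a :: "nat \<Rightarrow> int" and d p :: nat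
  assumes "d \<ge> 1"
    and "\<forall>n. u (n + d) = (\<Sum>i<d. a i * u (n + i))"
    and "prime p" and "p = CARD('p::prime_card)"
    and "p > d + 1"
    and "\<not> int p dvd a 0"
  shows "\<exists>(M::nat) (F :: nat \<Rightarrow> 'p padic \<Rightarrow> 'p padic).
    0 < M \<and> M < p ^ (d ^ 2) \<and>
    (\<forall>l<M.
      padic_analytic (F l) \<and>
      (\<forall>n. F l (of_nat n) = of_int (u (M * n + l))) \<and>
      ((\<exists>x\<in>padic_ints. F l x \<noteq> 0) \<longrightarrow>
        min_coeff_val (F l) = Min {padic_val ((fwd_diff ^^ j) (F l) 0) |j. j \<le> d - 1} \<and>
        last_min_index (F l) =
          Max {j. j \<le> d - 1 \<and> padic_val ((fwd_diff ^^ j) (F l) 0) = min_coeff_val (F l)}))"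
proof -
  have d: "d > 0" "d + 1 < CARD('p)" using assms by auto
  have u: "u (n + d) = (\<Sum>i<d. a i * u (n + i))" for n using assms(2) by blast
  obtain M c where M: "0 < M" "M < p ^ d\<^sup>2" and
    ex: "\<And>l. \<exists>w. (\<forall>n. u (M * n + l) = (\<Sum>k\<le>n. int (n choose k) * (int p ^ k * w k))) \<and>
      (\<forall>k. w (k + d) = (\<Sum>i<d. c i * w (k + i)))"
    using linear_recurrence_interpolation[OF assms(1) u assms(3,6)] by blast
  define P where "P l F \<longleftrightarrow> padic_analytic F \<and>
      (\<forall>n. F (of_nat n) = of_int (u (M * n + l))) \<and>
      ((\<exists>x\<in>padic_ints. F x \<noteq> 0) \<longrightarrow>
        min_coeff_val F = Min {padic_val ((fwd_diff ^^ j) F 0) |j. j \<le> d - 1} \<and>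
        last_min_index F =
          Max {j. j \<le> d - 1 \<and> padic_val ((fwd_diff ^^ j) F 0) = min_coeff_val F})"
    for l and F :: "'p padic \<Rightarrow> 'p padic"
  have "\<exists>F. P l F" for l
  proof -
    obtain w where w: "\<And>n. u (M * n + l) = (\<Sum>k\<le>n. int (n choose k) * (int p ^ k * w k))"
      and rec: "\<And>k. w (k + d) = (\<Sum>i<d. c i * w (k + i))" using ex by blast
    obtain F :: "'p padic \<Rightarrow> 'p padic" where F: "padic_analytic F"
      "\<And>n. F (of_nat n) = of_int (\<Sum>k\<le>n. int (n choose k) * (int CARD('p) ^ k * w k))"
      "(\<exists>x\<in>padic_ints. F x \<noteq> 0) \<Longrightarrow>
        min_coeff_val F = Min {padic_val ((fwd_diff ^^ j) F 0) |j. j \<le> d - 1} \<and>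
        last_min_index F =
          Max {j. j \<le> d - 1 \<and> padic_val ((fwd_diff ^^ j) F 0) = min_coeff_val F}"
      using interpolation_analytic[OF d rec] by blast
    have "F (of_nat n) = of_int (u (M * n + l))" for n
      by (simp only: F(2) w assms(4))
    then have "P l F" unfolding P_def using F(1,3) by simp
    then show ?thesis by (rule exI[of _ F])
  qed
  then obtain F where "\<forall>l<M. P l (F l)" by metis
  then show ?thesis unfolding P_def by (intro exI[of _ M] exI[of _ F] conjI M)
qed

end
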